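(* Let $n\ge2$, $1\le p\le n-1$, and $1\le r\le n-p$. Let $\pi\in S_n$ be a $p$-resultant permutation such that $r$ is a left-to-right maximum of $(\pi_1,\dots,\pi_{n-p})$. Suppose the left-to-right maxima of $(\pi_1,\dots,\pi_{n-p})$ are, in increasing order, $i_1<\dots<i_a<r<j_1<\dots<j_b$ (with $a,b\ge0$), and that $(\pi_{n-p+1},\dots,\pi_n)$ has $k$ right-to-left minima. Let $N_\pi$ be the number of $\sigma\in S_{n-1}$ such that $\sigma^{(r,p)}$ topples to $\pi$. Then $N_\pi=\Delta^a\big(B_{b,k}\big)=\sum_{t=0}^{a}(-1)^{a-t}\binom{a}{t}B_{b+t,k}$, with $\Delta$ acting on the first index.
   Context: For $m\ge1$, $1\le p\le m$: sites are $0,\dots,m+1$; a configuration in $\mathcal{S}(m,p)$ places $m+1$ distinct chips labeled $1,\dots,m+1$ with sites $0,m+1$ empty, one chip at each site of $\{1,\dots,m\}\setminus\{p\}$ and two chips at site $p$. Toppling: while some site holds at least two chips, choose such a site $i$ and two chips $\alpha<\beta$ there and move $\alpha$ to $i-1$, $\beta$ to $i+1$. It is known this terminates with at most one chip per site and the final configuration is independent of the choices; reading labels left to right gives a permutation in $S_{m+1}$ to which the configuration topples. For $\sigma\in S_m$, $r\in[m+1]$, $\sigma^{(r,p)}$ places at site $i$ ($1\le i\le m$) chip $\sigma_i$ if $\sigma_i<r$ and $\sigma_i+1$ otherwise, plus chip $r$ at site $p$. $\pi\in S_n$ is $p$-resultant if some configuration in $\mathcal{S}(n-1,p)$ topples to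 it. Left-to-right maximum of $a_1\cdots a_k$: an entry $a_j=\max\{a_1,\dots,a_j\}$; right-to-left minimum: an entry $a_j=\min\{a_j,\dots,a_k\}$. Forward difference $\Delta f(m)=f(m+1)-f(m)$. Poly-Bernoulli numbers of type B: $\sum_{n\ge0}B_{n,k}\frac{x^n}{n!}=\frac{\mathrm{Li}_{-k}(1-e^{-x})}{1-e^{-x}}$, $\mathrm{Li}_s(z)=\sum_{i\ge1}z^i/i^s$; equivalently $B_{n,k}=\sum_{m=0}^{\min(n,k)}(m!)^2\left\{{n+1\atop m+1}\right\}\left\{{k+1\atop m+1}\right\}$. *)

theory Defs
  imports Main "HOL-Combinatorics.Stirling"
begin

(* A chip configuration: sites are integers, each site holds a finite set of chip labels. *)
type_synonym config = "int \<Rightarrow> nat set"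

(* Permutations of [n], as lists pi with pi_i = pi ! (i-1). *)
definition perm_list :: "nat \<Rightarrow> nat list \<Rightarrow> bool" where
  "perm_list n xs \<longleftrightarrow> length xs = n \<and> distinct xs \<and> set xs = {1..n}"

definition topple_step :: "config \<Rightarrow> config \<Rightarrow> bool" where
  "topple_step c c' \<longleftrightarrow> (\<exists>i \<alpha> \<beta>. \<alpha> \<in> c i \<and> \<beta> \<in> c i \<and> \<alpha> < \<beta> \<and>
     c' = c(i - 1 := c (i - 1) \<union> {\<alpha>}, i := c i - {\<alpha>, \<beta>}, i + 1 := c (i + 1) \<union> {\<beta>}))"

definition stable :: "config \<Rightarrow> bool" where
  "stable c \<longleftrightarrow> (\<forall>i. card (c i) \<le> 1 \<and> finite (c i))"

definition reads_as :: "config \<Rightarrow> nat list \<Rightarrow> bool" where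
  "reads_as c xs \<longleftrightarrow> (\<exists>s :: nat \<Rightarrow> int. (\<forall>j. Suc j < length xs \<longrightarrow> s j < s (Suc j)) \<and>
      (\<forall>j < length xs. c (s j) = {xs ! j}) \<and>
      (\<forall>i. i \<notin> s ` {..<length xs} \<longrightarrow> c i = {}))"

(* c topples to the permutation xs: toppling reaches a stable configuration reading as xs.
   (The final configuration is known to be independent of choices.) *)
definition topples_to :: "config \<Rightarrow> nat list \<Rightarrow> bool" where
  "topples_to c xs \<longleftrightarrow> (\<exists>c'. topple_step\<^sup>*\<^sup>* c c' \<and> stable c' \<and> reads_as c' xs)"

definition config_S :: "nat \<Rightarrow> nat \<Rightarrow> config set" where
  "config_S m p = {c. (\<Union>i. c i) = {1..m+1} \<and>
      (\<forall>i j. i \<noteq> j \<longrightarrow> c i \<inter> c j = {}) \<and>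
      (\<forall>i. (i < 1 \<or> i > int m) \<longrightarrow> c i = {}) \<and>
      (\<forall>i. 1 \<le> i \<and> i \<le> int m \<and> i \<noteq> int p \<longrightarrow> card (c i) = 1) \<and>
      card (c (int p)) = 2}"

definition sigma_rp :: "nat list \<Rightarrow> nat \<Rightarrow> nat \<Rightarrow> config" where
  "sigma_rp \<sigma> r p = (\<lambda>i. (if 1 \<le> i \<and> i \<le> int (length \<sigma>) then
        {let v = \<sigma> ! (nat i - 1) in if v < r then v else v + 1} else {})
      \<union> (if i = int p then {r} else {}))"

definition p_resultant :: "nat \<Rightarrow> nat \<Rightarrow> nat list \<Rightarrow> bool" where
  "p_resultant n p \<pi> \<longleftrightarrow> (\<exists>c \<in> config_S (n - 1) p. topples_to c \<pi>)"

definition ltr_maxima :: "nat list \<Rightarrow> nat set" where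
  "ltr_maxima xs = {xs ! j | j. j < length xs \<and> xs ! j = Max (set (take (Suc j) xs))}"

definition rtl_minima :: "nat list \<Rightarrow> nat set" where
  "rtl_minima xs = {xs ! j | j. j < length xs \<and> xs ! j = Min (set (drop j xs))}"

definition polyB :: "nat \<Rightarrow> nat \<Rightarrow> int" where
  "polyB n k = (\<Sum>m = 0..min n k. int ((fact m)^2 * Stirling (n+1) (m+1) * Stirling (k+1) (m+1)))"

definition fwd_diff :: "(nat \<Rightarrow> int) \<Rightarrow> nat \<Rightarrow> int" where
  "fwd_diff f m = f (m + 1) - f m"

end

theory Submission
  imports Defs "HOL-Library.Multiset"
begin

text \<open>
  The final configuration is reached by \<open>n - p\<close> left-going waves of topplings. Together they act as a
  rectangular network of comparators: the chips at sites \<open>1, ..., p\<close> enter as rows, the extra chip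
  followed by the chips at sites \<open>p + 1, ..., n - 1\<close> enter as columns, and every comparator passes
  the larger chip along its row and the smaller one along its column. The column outputs form
  \<open>\<pi>\<^sub>1 ... \<pi>\<^bsub>n-p\<^esub>\<close>, the row outputs form the rest, and the latter are the \<open>p\<close> largest labels.

  Undoing one row with output \<open>z\<close> means choosing a subset of the left-to-right maxima of the current
  word, shifting the chosen ones cyclically and putting \<open>z\<close> at the last chosen position. Unless the
  subset is empty, \<open>z\<close> enters the word, which can be continued only if \<open>z\<close> is a right-to-left
  minimum of the rows. So \<open>N\<^sub>\<pi>\<close> counts \<open>k\<close> successive choices after which \<open>r\<close> is in front, and it
  depends on \<open>(a, b, k)\<close> only. The recurrence in \<open>k\<close> is solved by the differences of the
  poly-Bernoulli numbers.
\<close>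

section \<open>Poly-Bernoulli numbers and their differences\<close>

text \<open>In closed form \<open>\<Sum>d\<le>n. (n choose d) * f d\<close>.\<close>

fun binomial_transform :: "(nat \<Rightarrow> int) \<Rightarrow> nat \<Rightarrow> int" where
  "binomial_transform f 0 = f 0"
| "binomial_transform f (Suc n) = binomial_transform (\<lambda>d. f (Suc d)) n + binomial_transform f n"

lemma binomial_transform_add: "binomial_transform (\<lambda>d. f d + g d) n = binomial_transform f n + binomial_transform g n"
  by (induction n arbitrary: f g) auto

lemma binomial_transform_cmult: "binomial_transform (\<lambda>d. a * f d) n = a * binomial_transform f n"
  by (induction n arbitrary: f) (auto simp: algebra_simps)

lemma binomial_transform_zero [simp]: "binomial_transform (\<lambda>d. 0) n = 0"
  by (induction n) auto

lemma binomial_transform_sum: "binomial_transform (\<lambda>d. \<Sum>m\<in>M. f m d) n = (\<Sum>m\<in>M. binomial_transform (f m) n)"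
  by (induction M rule: infinite_finite_induct) (auto simp: binomial_transform_add)

lemma binomial_transform_shift: "binomial_transform (\<lambda>d. f (Suc d)) n = binomial_transform f (Suc n) - binomial_transform f n"
  by simp

text \<open>In a set of \<open>n + 1\<close> elements, take away the block of a distinguished one:
  the \<open>d\<close> elements outside it form the other \<open>m\<close> blocks.\<close>

lemma binomial_transform_Stirling: "binomial_transform (\<lambda>d. int (Stirling d m)) n = int (Stirling (Suc n) (Suc m))"
proof (induction n arbitrary: m)
  case 0
  show ?case by (cases m) auto
next
  case (Suc n)
  show ?case
  proof (cases m)
    case 0
    then show ?thesis using Suc.IH[of 0] by simp
  next
    case (Suc j)
    have "binomial_transform (\<lambda>d. int (Stirling (Suc d) m)) n
        = int (Suc j) * int (Stirling (Suc n) (Suc m)) + int (Stirling (Suc n) m)"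
      using Suc.IH[of "Suc j"] Suc.IH[of j] Suc
      by (simp add: binomial_transform_add binomial_transform_cmult algebra_simps)
    then show ?thesis using Suc.IH[of m] Suc by (simp add: algebra_simps)
  qed
qed

text \<open>Surplus terms contain a vanishing Stirling number, so different first indices may share
  one range.\<close>

lemma polyB_eq_sum_atMost:
  assumes "min n k \<le> M"
  shows "polyB n k = (\<Sum>m\<le>M. (fact m)\<^sup>2 * int (Stirling (n+1) (m+1)) * int (Stirling (k+1) (m+1)))"
  unfolding polyB_def
  by (rule sum.mono_neutral_cong_left) (use assms in \<open>auto simp: min_def not_le split: if_splits\<close>)

lemma polyB_0 [simp]: "polyB n 0 = 1"
proof -
  have "Stirling (Suc n) (Suc 0) = 1" by (induction n) auto
  then show ?thesis by (simp add: polyB_def)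
qed

text \<open>The case \<open>a = 0\<close> of \<open>diffB_Suc\<close>. All terms are expanded in
  \<open>S (Suc k) (Suc m)\<close>, and the coefficients agree for each \<open>m\<close>.\<close>

lemma polyB_Suc:
  "polyB l (Suc k) = polyB l k - polyB (Suc l) k + binomial_transform (\<lambda>d. polyB (Suc d) k) l"
proof -
  define c :: "nat \<Rightarrow> int" where "c m = (fact m)\<^sup>2" for m
  define S where "S i j = int (Stirling i j)" for i j
  have SS: "S (Suc i) (Suc j) = int (Suc j) * S i (Suc j) + S i j" for i j
    by (simp add: S_def algebra_simps)
  have B: "polyB i k = (\<Sum>m\<le>k. c m * S (Suc i) (Suc m) * S (Suc k) (Suc m))" for i
    unfolding c_def S_def by (subst polyB_eq_sum_atMost[where M = k]) auto
  have cS: "c (Suc m) = (int (Suc m))\<^sup>2 * c m" for m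
    by (simp add: c_def power_mult_distrib)
  have top: "S (Suc k) (Suc (Suc k)) = 0" "S (Suc k) 0 = 0" by (simp_all add: S_def)
  have "polyB l (Suc k) = (\<Sum>m\<le>Suc k. c m * S (Suc l) (Suc m) * S (Suc (Suc k)) (Suc m))"
    unfolding c_def S_def by (subst polyB_eq_sum_atMost[where M = "Suc k"]) auto
  also have "\<dots> = (\<Sum>m\<le>Suc k. c m * S (Suc l) (Suc m) * int (Suc m) * S (Suc k) (Suc m))
      + (\<Sum>m\<le>Suc k. c m * S (Suc l) (Suc m) * S (Suc k) m)"
    unfolding SS[of "Suc k"] sum.distrib[symmetric] by (rule sum.cong) (auto simp: algebra_simps)
  also have "(\<Sum>m\<le>Suc k. c m * S (Suc l) (Suc m) * S (Suc k) m)
      = (\<Sum>m\<le>k. c (Suc m) * S (Suc l) (Suc (Suc m)) * S (Suc k) (Suc m))"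
    by (subst sum.atMost_Suc_shift) (simp add: top)
  finally have L: "polyB l (Suc k) =
      (\<Sum>m\<le>k. c m * S (Suc l) (Suc m) * int (Suc m) * S (Suc k) (Suc m))
      + (\<Sum>m\<le>k. c (Suc m) * S (Suc l) (Suc (Suc m)) * S (Suc k) (Suc m))"
    by (simp add: top)
  \<comment> \<open>Shifting the argument by two takes a second difference of the transform, here
    that of \<open>S d (Suc m)\<close>.\<close>
  have bS: "binomial_transform (\<lambda>d. S (Suc (Suc d)) (Suc m)) l
      = S (Suc (Suc (Suc l))) (Suc (Suc m)) - 2 * S (Suc (Suc l)) (Suc (Suc m))
        + S (Suc l) (Suc (Suc m))" for m
    using binomial_transform_shift[of "\<lambda>d. S (Suc d) (Suc m)" l] binomial_transform_shift[of "\<lambda>d. S d (Suc m)" l]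
      binomial_transform_shift[of "\<lambda>d. S d (Suc m)" "Suc l"] binomial_transform_Stirling[of "Suc m"]
    unfolding S_def by (simp del: binomial_transform.simps Stirling.simps)
  have "binomial_transform (\<lambda>d. polyB (Suc d) k) l
      = (\<Sum>m\<le>k. binomial_transform (\<lambda>d. (c m * S (Suc k) (Suc m)) * S (Suc (Suc d)) (Suc m)) l)"
    unfolding B binomial_transform_sum[symmetric] by (simp add: mult_ac)
  also have "\<dots> = (\<Sum>m\<le>k. c m * S (Suc k) (Suc m) * (S (Suc (Suc (Suc l))) (Suc (Suc m))
      - 2 * S (Suc (Suc l)) (Suc (Suc m)) + S (Suc l) (Suc (Suc m))))"
    by (simp only: binomial_transform_cmult bS)
  finally have R: "binomial_transform (\<lambda>d. polyB (Suc d) k) l = \<dots>" .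
  show ?thesis
    unfolding L R B[of l] B[of "Suc l"] sum.distrib[symmetric] sum_subtractf[symmetric]
    by (rule sum.cong) (simp_all add: cS SS power2_eq_square algebra_simps)
qed

definition diffB :: "nat \<Rightarrow> nat \<Rightarrow> nat \<Rightarrow> int" where
  "diffB k a b = (fwd_diff ^^ a) (\<lambda>m. polyB m k) b"

lemma diffB_Suc_left: "diffB k (Suc a) b = diffB k a (Suc b) - diffB k a b"
  by (simp add: diffB_def fwd_diff_def)

lemma diffB_0: "diffB k 0 b = polyB b k"
  by (simp add: diffB_def)

text \<open>\<open>polyB b 0\<close> is constantly 1, so proper differences vanish. This matches
  \<open>undo_count\<close> with no rows left, where \<open>r\<close> must be in front.\<close>

lemma diffB_k0: "diffB 0 a b = (if a = 0 then 1 else 0)"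
  by (induction a arbitrary: b) (auto simp: diffB_Suc_left diffB_0)

text \<open>The identity for \<open>Suc a\<close> is the difference in \<open>b\<close> of the one
  for \<open>a\<close>. Its right-hand side has the shape produced by
  \<open>keep_sum_marked\<close>.\<close>

lemma diffB_Suc:
  "diffB (Suc k) a b
     = diffB k a b - diffB k a (Suc b) + binomial_transform (\<lambda>s. binomial_transform (\<lambda>d. diffB k s (Suc d)) b) a"
proof (induction a arbitrary: b)
  case 0
  then show ?case by (simp add: diffB_0 polyB_Suc)
next
  case (Suc a)
  \<comment> \<open>The difference in \<open>b\<close> cancels one of the two equal summands; what
    is left is the outer transform at \<open>Suc a\<close>.\<close>
  have "binomial_transform (\<lambda>s. binomial_transform (\<lambda>d. diffB k s (Suc d)) (Suc b)) a
      = binomial_transform (\<lambda>s. binomial_transform (\<lambda>d. diffB k (Suc s) (Suc d)) b) a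
        + 2 * binomial_transform (\<lambda>s. binomial_transform (\<lambda>d. diffB k s (Suc d)) b) a"
  proof -
    have "binomial_transform (\<lambda>d. diffB k s (Suc (Suc d))) b
        = binomial_transform (\<lambda>d. diffB k (Suc s) (Suc d)) b + binomial_transform (\<lambda>d. diffB k s (Suc d)) b" for s
      unfolding binomial_transform_add[symmetric] by (simp add: diffB_Suc_left)
    then show ?thesis by (simp add: binomial_transform_add binomial_transform_cmult)
  qed
  then show ?case by (simp add: Suc.IH diffB_Suc_left del: binomial_transform.simps(2)) (simp add: diffB_Suc_left)
qed

lemma fwd_diff_funpow:
  "(fwd_diff ^^ a) f b = (\<Sum>t=0..a. (-1) ^ (a - t) * int (a choose t) * f (b + t))"
  unfolding atLeast0AtMost
proof (induction a arbitrary: b)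
  case 0
  then show ?case by simp
next
  case (Suc a)
  let ?h = "\<lambda>t. (-1) ^ (Suc a - t) * int (a choose t) * f (b + t)"
  have "(\<Sum>t\<le>Suc a. (-1) ^ (Suc a - t) * int (Suc a choose t) * f (b + t))
     = ?h 0 + (\<Sum>t\<le>a. (-1) ^ (a - t) * int (a choose t) * f (Suc b + t) + ?h (Suc t))"
    by (subst sum.atMost_Suc_shift) (simp add: algebra_simps)
  also have "\<dots> = (fwd_diff ^^ a) f (Suc b) + (\<Sum>t\<le>Suc a. ?h t)"
    unfolding Suc.IH sum.distrib sum.atMost_Suc_shift[of ?h] by simp
  also have "(\<Sum>t\<le>Suc a. ?h t) = - (fwd_diff ^^ a) f b"
    unfolding Suc.IH by (simp add: Suc_diff_le sum_negf)
  finally show ?case by (simp add: fwd_diff_def[of "(fwd_diff ^^ a) f"])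
qed

section \<open>Confluence of toppling\<close>

text \<open>
  This invariant forbids two adjacent unstable sites and sites with three chips, so that any two
  possible topplings commute.
\<close>

definition doubles_separated :: "config \<Rightarrow> bool" where
  "doubles_separated c \<longleftrightarrow> (\<forall>i. finite (c i) \<and> card (c i) \<le> 2) \<and>
     (\<forall>i j. i < j \<longrightarrow> card (c i) = 2 \<longrightarrow> card (c j) = 2 \<longrightarrow> (\<exists>l. i < l \<and> l < j \<and> c l = {}))"

definition topple_at :: "int \<Rightarrow> nat \<Rightarrow> nat \<Rightarrow> config \<Rightarrow> config" where
  "topple_at i \<alpha> \<beta> c = c(i - 1 := c (i - 1) \<union> {\<alpha>}, i := c i - {\<alpha>, \<beta>}, i + 1 := c (i + 1) \<union> {\<beta>})"

lemma topple_step_iff: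
  "topple_step c d \<longleftrightarrow> (\<exists>i \<alpha> \<beta>. \<alpha> \<in> c i \<and> \<beta> \<in> c i \<and> \<alpha> < \<beta> \<and> d = topple_at i \<alpha> \<beta> c)"
  by (simp add: topple_step_def topple_at_def)

lemma topple_stepI:
  "\<alpha> \<in> c i \<Longrightarrow> \<beta> \<in> c i \<Longrightarrow> \<alpha> < \<beta> \<Longrightarrow> topple_step c (topple_at i \<alpha> \<beta> c)"
  by (auto simp: topple_step_iff)

lemma card_le_2_eq:
  assumes "finite A" "card A \<le> 2" "\<alpha> \<in> A" "\<beta> \<in> A" "\<alpha> < (\<beta>::nat)"
  shows "A = {\<alpha>, \<beta>}"
  using card_seteq[of A "{\<alpha>, \<beta>}"] assms by auto

text \<open>Toppling \<open>i\<close> leaves a hole that separates doubles on its two sides. On one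
  side, a neighbour of \<open>i\<close> becomes double only if it was occupied, so the old hole lies
  beyond it and still separates.\<close>

lemma doubles_separated_topple:
  assumes "doubles_separated c" "topple_step c d"
  shows "doubles_separated d"
proof -
  obtain i \<alpha> \<beta> where ab: "\<alpha> \<in> c i" "\<beta> \<in> c i" "\<alpha> < \<beta>" and d: "d = topple_at i \<alpha> \<beta> c"
    using assms(2) by (auto simp: topple_step_iff)
  have fin: "finite (c j)" and le2: "card (c j) \<le> 2" for j
    using assms(1) by (auto simp: doubles_separated_def)
  have sep: "\<exists>l. j < l \<and> l < j' \<and> c l = {}" if "j < j'" "card (c j) = 2" "card (c j') = 2" for j j'
    using assms(1) that by (auto simp: doubles_separated_def)
  have ci: "c i = {\<alpha>, \<beta>}" using card_le_2_eq fin le2 ab by blast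
  have ci2: "card (c i) = 2" using ci ab by simp
  have l1: "card (c (i - 1)) \<le> 1"
    using sep[of "i - 1" i] ci2 le2[of "i - 1"] by force
  have r1: "card (c (i + 1)) \<le> 1"
    using sep[of i "i + 1"] ci2 le2[of "i + 1"] by force
  have di: "d i = {}" "d (i - 1) = insert \<alpha> (c (i - 1))" "d (i + 1) = insert \<beta> (c (i + 1))"
    using ci by (auto simp: d topple_at_def)
  have dj: "d j = c j" if "j \<noteq> i" "j \<noteq> i - 1" "j \<noteq> i + 1" for j
    using that by (auto simp: d topple_at_def)
  have lne: "c (i - 1) \<noteq> {}" if "card (d (i - 1)) = 2" using that di by auto
  have rne: "c (i + 1) \<noteq> {}" if "card (d (i + 1)) = 2" using that di by auto
  have "finite (d j) \<and> card (d j) \<le> 2" for j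
  proof -
    consider "j = i" | "j = i - 1" | "j = i + 1" | "j \<noteq> i" "j \<noteq> i - 1" "j \<noteq> i + 1" by blast
    then show ?thesis
      by cases (use fin le2 l1 r1 di dj in \<open>auto simp: card_insert_if\<close>)
  qed
  moreover have "\<exists>l. j < l \<and> l < j' \<and> d l = {}"
    if jj: "j < j'" "card (d j) = 2" "card (d j') = 2" for j j'
  proof (cases "j < i \<and> i < j'")
    case True
    then show ?thesis using di by blast
  next
    case False
    have ji: "j \<noteq> i" "j' \<noteq> i" using jj di by auto
    consider "j' < i" | "i < j" using False ji by linarith
    then show ?thesis
    proof cases
      case 1
      have cj: "card (c j) = 2" using 1 jj dj by auto
      show ?thesis
      proof (cases "j' = i - 1")
        case True
        then have "card (d (i - 1)) = 2" using jj by simp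
        with sep[of j i] cj ci2 1 jj lne obtain l where "j < l" "l < i" "c l = {}" "l \<noteq> i - 1" by auto
        then show ?thesis using True dj by (intro exI[of _ l]) auto
      next
        case False
        then obtain l where "j < l" "l < j'" "c l = {}"
          using sep[of j j'] cj 1 jj dj by auto
        then show ?thesis using False 1 dj by (intro exI[of _ l]) auto
      qed
    next
      case 2
      have cj: "card (c j') = 2" using 2 jj dj by auto
      show ?thesis
      proof (cases "j = i + 1")
        case True
        then have "card (d (i + 1)) = 2" using jj by simp
        with sep[of i j'] cj ci2 2 jj rne obtain l where "i < l" "l < j'" "c l = {}" "l \<noteq> i + 1" by auto
        then show ?thesis using True dj by (intro exI[of _ l]) auto
      next
        case False
        then obtain l where "j < l" "l < j'" "c l = {}"
          using sep[of j j'] cj 2 jj dj by auto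
        then show ?thesis using False 2 dj by (intro exI[of _ l]) auto
      qed
    qed
  qed
  ultimately show ?thesis unfolding doubles_separated_def by blast
qed

text \<open>The topplings can share only the site \<open>i + 1 = j - 1\<close>, and both merely add
  a chip there.\<close>

lemma topple_at_commute:
  assumes "i + 1 < j"
  shows "topple_at i \<alpha> \<beta> (topple_at j \<gamma> \<delta> c) = topple_at j \<gamma> \<delta> (topple_at i \<alpha> \<beta> c)"
  using assms by (auto simp: topple_at_def fun_eq_iff add.commute)

text \<open>A double site holds just the two chips to be moved, so it determines its toppling.
  Distinct double sites are not adjacent, so their topplings commute.\<close>

lemma topple_diamond:
  assumes "doubles_separated c" "topple_step c d" "topple_step c e"
  shows "d = e \<or> (\<exists>f. topple_step d f \<and> topple_step e f)"
proof -
  obtain i \<alpha> \<beta> where d: "\<alpha> \<in> c i" "\<beta> \<in> c i" "\<alpha> < \<beta>" "d = topple_at i \<alpha> \<beta> c"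
    using assms(2) by (auto simp: topple_step_iff)
  obtain j \<gamma> \<delta> where e: "\<gamma> \<in> c j" "\<delta> \<in> c j" "\<gamma> < \<delta>" "e = topple_at j \<gamma> \<delta> c"
    using assms(3) by (auto simp: topple_step_iff)
  have fin: "finite (c j)" and le2: "card (c j) \<le> 2" for j
    using assms(1) by (auto simp: doubles_separated_def)
  have ci: "c i = {\<alpha>, \<beta>}" and cj: "c j = {\<gamma>, \<delta>}"
    using card_le_2_eq fin le2 d e by blast+
  have sep: "\<exists>l. i < l \<and> l < j" if "i < j" "card (c i) = 2" "card (c j) = 2" for i j
    using assms(1) that unfolding doubles_separated_def by blast
  have c2: "card (c i) = 2" "card (c j) = 2" using ci cj d e by auto
  consider "i = j" | "i + 1 < j" | "j + 1 < i" using sep[of i j] sep[of j i] c2 by force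
  then show ?thesis
  proof cases
    case 1
    then have "\<alpha> = \<gamma>" "\<beta> = \<delta>" using ci cj d(3) e(3) by (auto simp: doubleton_eq_iff)
    then show ?thesis using 1 d e by simp
  next
    case 2
    then have "topple_step d (topple_at j \<gamma> \<delta> d)" "topple_step e (topple_at i \<alpha> \<beta> e)"
      using d e by (intro topple_stepI; simp add: topple_at_def)+
    then show ?thesis using topple_at_commute[OF 2] d e by metis
  next
    case 3
    then have "topple_step d (topple_at j \<gamma> \<delta> d)" "topple_step e (topple_at i \<alpha> \<beta> e)"
      using d e by (intro topple_stepI; simp add: topple_at_def)+
    then show ?thesis using topple_at_commute[OF 3] d e by metis
  qed
qed

lemma stable_no_topple: "stable s \<Longrightarrow> \<not> topple_step s d"
proof
  assume "stable s" "topple_step s d"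
  then obtain i \<alpha> \<beta> where "\<alpha> \<in> s i" "\<beta> \<in> s i" "\<alpha> < \<beta>" "card (s i) \<le> 1" "finite (s i)"
    by (auto simp: topple_step_iff stable_def)
  then show False using card_le_Suc0_iff_eq[of "s i"] by auto
qed

text \<open>The diamond is pushed along the given path: whichever step is taken first,
  \<open>s\<close> stays reachable.\<close>

lemma topple_to_stable_from_successor:
  assumes "topple_step\<^sup>*\<^sup>* c s" "stable s" "doubles_separated c" "topple_step c d"
  shows "topple_step\<^sup>*\<^sup>* d s"
  using assms(1,3,4)
proof (induction arbitrary: d rule: converse_rtranclp_induct)
  case base
  then show ?case using stable_no_topple assms(2) by blast
next
  case (step c c1)
  from topple_diamond[OF step.prems(1) step.hyps(1) step.prems(2)]
  consider "d = c1" | f where "topple_step c1 f" "topple_step d f" by blast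
  then show ?case
  proof cases
    case 1
    then show ?thesis using step.hyps by simp
  next
    case 2
    then show ?thesis
      using step.IH[OF doubles_separated_topple[OF step.prems(1) step.hyps(1)] 2(1)]
      by (meson converse_rtranclp_into_rtranclp)
  qed
qed

lemma stable_result_unique:
  assumes "topple_step\<^sup>*\<^sup>* c t" "topple_step\<^sup>*\<^sup>* c s" "stable s" "stable t" "doubles_separated c"
  shows "s = t"
  using assms(1,2,5)
proof (induction rule: converse_rtranclp_induct)
  case base
  then show ?case using stable_no_topple assms(4) by (metis converse_rtranclpE)
next
  case (step c c1)
  then show ?case
    using topple_to_stable_from_successor[OF step.prems(1) assms(3)] doubles_separated_topple by blast
qed

lemma topples_to_iff_reads_as:
  assumes "topple_step\<^sup>*\<^sup>* c s" "stable s" "doubles_separated c"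
  shows "topples_to c xs \<longleftrightarrow> reads_as s xs"
  unfolding topples_to_def using assms stable_result_unique by blast

text \<open>The sites must be the occupied sites of \<open>c\<close> in increasing order, so their
  enumeration is forced.\<close>

lemma reads_as_unique:
  assumes "reads_as c xs" "reads_as c ys"
  shows "xs = ys"
proof -
  have *: "\<exists>s :: nat \<Rightarrow> int. map s [0..<length xs] = sorted_list_of_set {i. c i \<noteq> {}}
      \<and> (\<forall>j<length xs. c (s j) = {xs ! j})" if R: "reads_as c xs" for xs
  proof -
    obtain s :: "nat \<Rightarrow> int" where s: "\<forall>j. Suc j < length xs \<longrightarrow> s j < s (Suc j)"
      "\<forall>j<length xs. c (s j) = {xs ! j}" "\<forall>i. i \<notin> s ` {..<length xs} \<longrightarrow> c i = {}"
      using R unfolding reads_as_def by blast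
    have "sorted_wrt (<) (map s [0..<length xs])"
      by (subst sorted_wrt_iff_nth_Suc_transp) (use s(1) in auto)
    moreover have "set (map s [0..<length xs]) = {i. c i \<noteq> {}}"
      using s(2,3) by (auto simp: image_iff) 
    ultimately have "map s [0..<length xs] = sorted_list_of_set {i. c i \<noteq> {}}"
      by (metis sorted_list_of_set.idem_if_sorted_distinct strict_sorted_iff)
    then show ?thesis using s(2) by blast
  qed
  obtain s t :: "nat \<Rightarrow> int" where
    s: "map s [0..<length xs] = sorted_list_of_set {i. c i \<noteq> {}}" "\<forall>j<length xs. c (s j) = {xs ! j}" and
    t: "map t [0..<length ys] = sorted_list_of_set {i. c i \<noteq> {}}" "\<forall>j<length ys. c (t j) = {ys ! j}"
    using *[OF assms(1)] *[OF assms(2)] by blast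
  have eq: "map s [0..<length xs] = map t [0..<length ys]" using s t by simp
  then have len: "length xs = length ys" by (metis length_map length_upt diff_zero)
  then have "\<forall>j<length xs. s j = t j" using eq by simp
  then show ?thesis using s(2) t(2) len by (auto intro: nth_equalityI)
qed

section \<open>Toppling as a network of comparisons\<close>

text \<open>
  One row: the chip \<open>w\<close> meets the stream \<open>xs\<close>; the result is the
  surviving maximum and the outgoing stream.
\<close>

fun bubble :: "nat \<Rightarrow> nat list \<Rightarrow> nat \<times> nat list" where
  "bubble w [] = (w, [])"
| "bubble w (x # xs) = (let (z, ys) = bubble (max w x) xs in (z, min w x # ys))"

text \<open>
  One column: the chip \<open>x\<close> arrives at the last site of \<open>ws\<close> and
  travels left; the result is the ejected chip and the new occupation, shifted by one site to
  the right.
\<close>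

fun wave :: "nat list \<Rightarrow> nat \<Rightarrow> nat \<times> nat list" where
  "wave [] x = (x, [])"
| "wave (w # ws) x = (let (c, ws') = wave ws x in (min w c, max w c # ws'))"

text \<open>
  The whole network, evaluated row by row; \<open>sweep_Cons_right\<close> evaluates it column
  by column instead.
\<close>

fun sweep :: "nat list \<Rightarrow> nat list \<Rightarrow> nat list \<times> nat list" where
  "sweep [] xs = (xs, [])"
| "sweep (w # ws) xs = (let (ys, zs) = sweep ws xs; (z, os) = bubble w ys in (os, z # zs))"

lemma sweep_Nil_right: "sweep ws [] = ([], ws)"
  by (induction ws) auto

text \<open>Each comparator has the same two inputs whether rows or columns are evaluated first.
  Topplings follow this column form, counting follows the rows.\<close>

lemma sweep_Cons_right:
  "sweep ws (x # xs) = (let (c, ws') = wave ws x; (ys, zs) = sweep ws' xs in (c # ys, zs))"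
  by (induction ws) (auto split: prod.splits)

lemma mset_bubble: "bubble w xs = (z, ys) \<Longrightarrow> add_mset z (mset ys) = add_mset w (mset xs)"
  by (induction xs arbitrary: w ys) (auto split: prod.splits simp: min_def max_def split: if_splits)

lemma mset_wave: "wave ws x = (c, ws') \<Longrightarrow> add_mset c (mset ws') = add_mset x (mset ws)"
  by (induction ws arbitrary: c ws')
    (auto split: prod.splits simp: min_def max_def add_mset_commute split: if_splits)

lemma mset_sweep: "sweep ws xs = (ys, zs) \<Longrightarrow> mset (ys @ zs) = mset (ws @ xs)"
proof (induction ws arbitrary: ys zs)
  case (Cons w ws)
  obtain ys' zs' where s: "sweep ws xs = (ys', zs')" by fastforce
  obtain z where b: "bubble w ys' = (z, ys)" and zs: "zs = z # zs'"
    using Cons.prems s by (auto split: prod.splits)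
  have "mset (ys @ zs) = add_mset z (mset ys) + mset zs'" by (simp add: zs)
  also have "\<dots> = add_mset w (mset (ys' @ zs'))" using mset_bubble[OF b] by simp
  finally show ?case using Cons.IH[OF s] by simp
qed simp

lemma length_wave: "wave ws x = (c, ws') \<Longrightarrow> length ws' = length ws"
  by (induction ws arbitrary: c ws') (auto split: prod.splits)

lemma length_bubble: "bubble w xs = (z, ys) \<Longrightarrow> length ys = length xs"
  by (induction xs arbitrary: w ys) (auto split: prod.splits)

lemma length_sweep: "sweep ws xs = (ys, zs) \<Longrightarrow> length ys = length xs \<and> length zs = length ws"
  by (induction ws arbitrary: ys zs) (auto split: prod.splits dest: length_bubble)

lemma bubble_max: "bubble w xs = (z, ys) \<Longrightarrow> w \<le> z \<and> (\<forall>y\<in>set ys. y \<le> z)"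
proof (induction xs arbitrary: w ys)
  case (Cons x xs)
  then obtain ys' where "bubble (max w x) xs = (z, ys')" "ys = min w x # ys'"
    by (auto split: prod.splits)
  then show ?case using Cons.IH[of "max w x" ys'] by auto
qed simp

text \<open>Each outgoing chip is the minimum of the carried chip and an entry of \<open>xs\<close>,
  so a bound on \<open>xs\<close> suffices whatever \<open>w\<close> is.\<close>

lemma bubble_bounded:
  "bubble w xs = (z, ys) \<Longrightarrow> (\<And>x. x \<in> set xs \<Longrightarrow> x \<le> u) \<Longrightarrow> y \<in> set ys \<Longrightarrow> y \<le> (u::nat)"
  by (induction xs arbitrary: w ys) (auto split: prod.splits simp: min.coboundedI2)

text \<open>The new row output bounds the outgoing stream by \<open>bubble_max\<close>. The other
  row outputs bound the incoming stream, hence by \<open>bubble_bounded\<close> the outgoing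
  one.\<close>

lemma sweep_le: "sweep ws xs = (ys, zs) \<Longrightarrow> y \<in> set ys \<Longrightarrow> z \<in> set zs \<Longrightarrow> y \<le> z"
proof (induction ws arbitrary: ys zs y z)
  case (Cons w ws)
  obtain ys' zs' where s: "sweep ws xs = (ys', zs')" by fastforce
  obtain z' where b: "bubble w ys' = (z', ys)" and zs: "zs = z' # zs'"
    using Cons.prems s by (auto split: prod.splits)
  show ?case using bubble_max[OF b] bubble_bounded[OF b, of z y] Cons.IH[OF s] Cons.prems zs by auto
qed simp

section \<open>Topplings on configurations written as lists of sites\<close>

definition config_of :: "nat set list \<Rightarrow> config" where
  "config_of L i = (if 0 \<le> i \<and> i < int (length L) then L ! nat i else {})"

abbreviation singletons :: "nat list \<Rightarrow> nat set list" where
  "singletons \<equiv> map (\<lambda>x. {x})"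

lemma config_of_topple:
  assumes "\<alpha> < \<beta>"
  shows "topple_step (config_of (A @ P # {\<alpha>, \<beta>} # Q # B)) (config_of (A @ (P \<union> {\<alpha>}) # {} # (Q \<union> {\<beta>}) # B))"
proof -
  let ?i = "int (length A) + 1"
  have "config_of (A @ P # {\<alpha>, \<beta>} # Q # B) ?i = {\<alpha>, \<beta>}"
    by (auto simp: config_of_def nth_append nat_add_distrib)
  moreover have "config_of (A @ (P \<union> {\<alpha>}) # {} # (Q \<union> {\<beta>}) # B) = topple_at ?i \<alpha> \<beta> (config_of (A @ P # {\<alpha>, \<beta>} # Q # B))"
  proof
    fix i :: int
    consider "i < 0" | k where "i = int k" "k < length A" | "i = int (length A)"
      | "i = int (length A) + 1" | "i = int (length A) + 2" | k where "i = int (length A + 3 + k)"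
    proof -
      have "\<exists>k. i = int (length A + 3 + k)" if "i > int (length A) + 2"
        using that by (intro exI[of _ "nat (i - int (length A) - 3)"]) auto
      moreover have "\<exists>k. i = int k \<and> k < length A" if "0 \<le> i" "i < int (length A)"
        using that by (intro exI[of _ "nat i"]) auto
      ultimately show ?thesis using that by (metis linorder_neqE zless_add1_eq linorder_not_less add_2_eq_Suc' 
        is_num_normalize(1) one_add_one)
    qed
    then show "config_of (A @ (P \<union> {\<alpha>}) # {} # (Q \<union> {\<beta>}) # B) i
        = topple_at ?i \<alpha> \<beta> (config_of (A @ P # {\<alpha>, \<beta>} # Q # B)) i"
      by cases (auto simp: config_of_def topple_at_def nth_append nat_add_distrib)
  qed
  ultimately show ?thesis using assms unfolding topple_step_iff by blast
qed

lemma config_of_topple_pair: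
  assumes "x \<noteq> y"
  shows "topple_step (config_of (A @ P # {x, y} # Q # B))
           (config_of (A @ (P \<union> {min x y}) # {} # (Q \<union> {max x y}) # B))"
proof (cases "x < y")
  case True
  then show ?thesis using config_of_topple[of x y A P Q B] by simp
next
  case False
  then show ?thesis using config_of_topple[of y x A P Q B] assms by (simp add: insert_commute min_def max_def)
qed

text \<open>A wave runs from right to left, so the induction topples the first site last. The block
  moves one site to the right: the hole marks its old left end, and its last chip lands on
  \<open>Q\<close>.\<close>

lemma config_of_wave:
  assumes "ws \<noteq> []" "distinct (x # ws)" "wave ws x = (c, ws')"
  shows "topple_step\<^sup>*\<^sup>* (config_of (A @ P # singletons (butlast ws) @ {last ws, x} # Q # B))
      (config_of (A @ (P \<union> {c}) # {} # singletons (butlast ws') @ (Q \<union> {last ws'}) # B))"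
  using assms
proof (induction ws arbitrary: A P c ws')
  case (Cons w ws)
  show ?case
  proof (cases "ws = []")
    case True
    then have "c = min w x" "ws' = [max w x]" "w \<noteq> x" using Cons.prems by auto
    then show ?thesis using config_of_topple_pair[of w x A P Q B] True by (simp add: r_into_rtranclp)
  next
    case False
    obtain c1 ws1 where w1: "wave ws x = (c1, ws1)" by fastforce
    have ws': "c = min w c1" "ws' = max w c1 # ws1" using Cons.prems w1 by auto
    have "set (c1 # ws1) = set (x # ws)" using mset_wave[OF w1] by (metis mset.simps(2) set_mset_mset)
    then have "w \<noteq> c1" using Cons.prems by auto
    have ne: "ws1 \<noteq> []" using length_wave[OF w1] False by auto
    \<comment> \<open>For the tail, the site of \<open>w\<close> takes the part of \<open>P\<close>
      and catches \<open>c1\<close>.\<close>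
    have 1: "topple_step\<^sup>*\<^sup>* (config_of ((A @ [P]) @ {w} # singletons (butlast ws) @ {last ws, x} # Q # B))
      (config_of ((A @ [P]) @ ({w} \<union> {c1}) # {} # singletons (butlast ws1) @ (Q \<union> {last ws1}) # B))"
      by (rule Cons.IH[OF False _ w1]) (use Cons.prems(2) in simp)
    have 2: "topple_step (config_of ((A @ [P]) @ ({w} \<union> {c1}) # {} # singletons (butlast ws1) @ (Q \<union> {last ws1}) # B))
      (config_of (A @ (P \<union> {c}) # {} # ({} \<union> {max w c1})
        # singletons (butlast ws1) @ (Q \<union> {last ws1}) # B))"
      using config_of_topple_pair[OF \<open>w \<noteq> c1\<close>, of A P "{}" "singletons (butlast ws1) @ (Q \<union> {last ws1}) # B"]
      by (simp add: ws' insert_commute)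
    have "butlast (w # ws) = w # butlast ws" "last (w # ws) = last ws"
      "butlast ws' = max w c1 # butlast ws1" "last ws' = last ws1"
      using False ne ws'(2) by simp_all
    with rtranclp_trans[OF 1 r_into_rtranclp[where r = topple_step, OF 2]] show ?thesis by simp
  qed
qed simp

text \<open>Each wave is one column: it ejects the next letter of \<open>ys\<close> and brings its
  rightmost chip to the first chip of the next column. \<open>us\<close> collects the letters
  already ejected.\<close>

lemma config_of_sweep:
  assumes "ws \<noteq> []" "distinct (ws @ x # xs)" "sweep ws (x # xs) = (ys, zs)"
  shows "topple_step\<^sup>*\<^sup>* (config_of (singletons us @ {} # singletons (butlast ws) @ {last ws, x} # singletons xs @ [{}]))
      (config_of (singletons (us @ ys) @ {} # singletons zs))"
  using assms
proof (induction xs arbitrary: us ws x ys)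
  case Nil
  obtain c ws' where w: "wave ws x = (c, ws')" by fastforce
  have "ys = [c]" "zs = ws'"
    using Nil.prems(3) by (simp_all add: w sweep_Cons_right sweep_Nil_right)
  have "ws' \<noteq> []" using length_wave[OF w] Nil.prems(1) by auto
  from \<open>ws' \<noteq> []\<close> have "singletons (butlast ws' @ [last ws']) = singletons ws'" by simp
  then have "singletons (butlast ws') @ [{last ws'}] = singletons ws'" by (simp only: map_append list.map)
  then show ?case
    using config_of_wave[OF Nil.prems(1) _ w, of "singletons us" "{}" "{}" "[]"] Nil.prems(2)
      \<open>ys = [c]\<close> \<open>zs = ws'\<close> by simp
next
  case (Cons y xs)
  obtain c ws' where w: "wave ws x = (c, ws')" by fastforce
  obtain ys' where ys: "sweep ws' (y # xs) = (ys', zs)" "ys = c # ys'"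
    using Cons.prems w by (auto simp: sweep_Cons_right[of ws] split: prod.splits)
  have m: "add_mset c (mset ws') = add_mset x (mset ws)" using mset_wave[OF w] .
  have "distinct (c # ws' @ y # xs)"
  proof -
    have "mset (c # ws' @ y # xs) = mset (ws @ x # y # xs)" using m by simp
    then show ?thesis using Cons.prems(2) mset_eq_imp_distinct_iff by blast
  qed
  then have d: "distinct (ws' @ y # xs)" by simp
  have ne: "ws' \<noteq> []" using length_wave[OF w] Cons.prems by auto
  have 1: "topple_step\<^sup>*\<^sup>* (config_of (singletons us @ {} # singletons (butlast ws) @ {last ws, x} # singletons (y # xs) @ [{}]))
     (config_of (singletons us @ ({} \<union> {c}) # {} # singletons (butlast ws') @ ({y} \<union> {last ws'}) # singletons xs @ [{}]))"
    using config_of_wave[OF Cons.prems(1) _ w, of "singletons us" "{}" "{y}" "singletons xs @ [{}]"] Cons.prems by simp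
  have 2: "topple_step\<^sup>*\<^sup>* (config_of (singletons us @ ({} \<union> {c}) # {} # singletons (butlast ws') @ ({y} \<union> {last ws'}) # singletons xs @ [{}]))
     (config_of (singletons (us @ ys) @ {} # singletons zs))"
    using Cons.IH[OF ne d ys(1), of "us @ [c]"] ys(2) by (simp add: insert_commute)
  show ?case by (rule rtranclp_trans[OF 1 2])
qed

section \<open>Starting configurations and their final words\<close>

definition initial_config :: "nat list \<Rightarrow> nat \<Rightarrow> nat \<Rightarrow> config" where
  "initial_config \<tau> x p i = (if 1 \<le> i \<and> i \<le> int (length \<tau>) then {\<tau> ! (nat i - 1)} else {})
      \<union> (if i = int p then {x} else {})"

lemma initial_config_eq_config_of:
  assumes "1 \<le> p" "p \<le> length \<tau>"
  shows "initial_config \<tau> x p = config_of ({} # singletons (butlast (take p \<tau>)) @ {last (take p \<tau>), x} # singletons (drop p \<tau>) @ [{}])"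
proof -
  obtain u w v where t: "\<tau> = u @ w # v" "length u = p - 1"
    using assms that[OF id_take_nth_drop[of "p - 1" \<tau>]] by simp
  have p: "p = Suc (length u)" using t assms by simp
  have eq: "{} # singletons (butlast (take p \<tau>)) @ {last (take p \<tau>), x} # singletons (drop p \<tau>) @ [{}]
     = {} # singletons u @ {w, x} # singletons v @ [{}]" by (simp add: t(1) p)
  show ?thesis unfolding eq
  proof
    fix i :: int
    consider "i \<le> 0" | k where "i = int (Suc k)"
      using that(2)[of "nat i - 1"] that(1) by linarith
    then show "initial_config \<tau> x p i = config_of ({} # singletons u @ {w, x} # singletons v @ [{}]) i"
    proof cases
      case 1
      then show ?thesis by (cases "i = 0") (auto simp: initial_config_def config_of_def p)
    next
      case 2
      have n: "nat (1 + int k) = Suc k" by simp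
      show ?thesis
        by (auto simp: 2 n initial_config_def config_of_def p t(1) nth_append nth_Cons split: nat.splits)
    qed
  qed
qed

lemma stable_config_of: "stable (config_of (singletons ys @ {} # singletons zs))"
  by (auto simp: stable_def config_of_def nth_append nth_Cons split: nat.splits)

lemma reads_as_config_of: "reads_as (config_of (singletons ys @ {} # singletons zs)) (ys @ zs)"
  unfolding reads_as_def
proof (intro exI conjI allI impI)
  let ?s = "\<lambda>j. if j < length ys then int j else int j + 1"
  show "?s j < ?s (Suc j)" for j by simp
  show "config_of (singletons ys @ {} # singletons zs) (?s j) = {(ys @ zs) ! j}" if "j < length (ys @ zs)" for j
    using that by (auto simp: config_of_def nth_append nat_add_distrib Suc_diff_le)
  show "config_of (singletons ys @ {} # singletons zs) i = {}" if "i \<notin> ?s ` {..<length (ys @ zs)}" for i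
  proof (rule ccontr)
    assume "config_of (singletons ys @ {} # singletons zs) i \<noteq> {}"
    then have *: "0 \<le> i" "i < int (length ys + length zs + 1)" "i \<noteq> int (length ys)"
      by (auto simp: config_of_def nth_append split: if_splits)
    show False
    proof (cases "i < int (length ys)")
      case True
      then have "i = ?s (nat i)" "nat i < length (ys @ zs)" using * by auto
      then show False using that by blast
    next
      case False
      then have "i = ?s (nat i - 1)" "nat i - 1 < length (ys @ zs)" using * by auto
      then show False using that by blast
    qed
  qed
qed

lemma doubles_separated_initial_config: "doubles_separated (initial_config \<tau> x p)"
proof -
  have le: "card (initial_config \<tau> x p i) \<le> (if i = int p then 2 else 1)" for i
    by (auto simp: initial_config_def card_insert_if)
  have "card (initial_config \<tau> x p i) \<le> 2" for i using le[of i] by (simp split: if_splits)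
  moreover have "i = int p" if "card (initial_config \<tau> x p i) = 2" for i
    using le[of i] that by (simp split: if_splits)
  moreover have "finite (initial_config \<tau> x p i)" for i by (auto simp: initial_config_def)
  ultimately show ?thesis unfolding doubles_separated_def by blast
qed

text \<open>The waves give one complete toppling sequence, and confluence excludes any other final
  word.\<close>

lemma topples_to_initial_config:
  assumes "1 \<le> p" "p \<le> length \<tau>" "distinct (x # \<tau>)"
  shows "topples_to (initial_config \<tau> x p) \<pi> \<longleftrightarrow>
    (\<exists>ys zs. sweep (take p \<tau>) (x # drop p \<tau>) = (ys, zs) \<and> \<pi> = ys @ zs)"
proof -
  obtain ys zs where s: "sweep (take p \<tau>) (x # drop p \<tau>) = (ys, zs)" by fastforce
  have "mset (take p \<tau>) + mset (drop p \<tau>) = mset \<tau>"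
    by (metis append_take_drop_id mset_append)
  then have "mset (take p \<tau> @ x # drop p \<tau>) = mset (x # \<tau>)" by simp
  then have d: "distinct (take p \<tau> @ x # drop p \<tau>)" using assms(3) mset_eq_imp_distinct_iff by blast
  have "topple_step\<^sup>*\<^sup>* (initial_config \<tau> x p) (config_of (singletons ys @ {} # singletons zs))"
    using config_of_sweep[OF _ d s, of "[]"] assms(1,2) by (fastforce simp: initial_config_eq_config_of)
  from topples_to_iff_reads_as[OF this stable_config_of doubles_separated_initial_config]
  show ?thesis using s reads_as_config_of reads_as_unique by auto
qed

lemma sigma_rp_eq_initial_config:
  "sigma_rp \<sigma> r p = initial_config (map (\<lambda>v. if v < r then v else v + 1) \<sigma>) r p"
  by (auto simp: sigma_rp_def initial_config_def fun_eq_iff Let_def)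

text \<open>Either of the two chips at site \<open>p\<close> may be called the extra one; the other
  completes the word \<tau>.\<close>

lemma config_S_eq_initial_config:
  assumes "c \<in> config_S m p" "1 \<le> p" "p \<le> m"
  obtains \<tau> x where "c = initial_config \<tau> x p" "distinct (x # \<tau>)" "length \<tau> = m"
proof -
  have c: "i \<noteq> j \<Longrightarrow> c i \<inter> c j = {}" "i < 1 \<or> i > int m \<Longrightarrow> c i = {}"
    "1 \<le> i \<and> i \<le> int m \<and> i \<noteq> int p \<Longrightarrow> card (c i) = 1" "card (c (int p)) = 2" for i j
    using assms(1) unfolding config_S_def by blast+
  obtain w x where wx: "c (int p) = {w, x}" "w \<noteq> x" using c(4) by (auto simp: card_2_iff)
  define f where "f j = (if Suc j = p then w else the_elem (c (int (Suc j))))" for j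
  define \<tau> where "\<tau> = map f [0..<m]"
  have f: "c (int (Suc j)) = {f j}" if "j < m" "Suc j \<noteq> p" for j
  proof -
    have "card (c (int (Suc j))) = 1" using that by (intro c(3)) linarith
    then obtain a where "c (int (Suc j)) = {a}" by (rule card_1_singletonE)
    then show ?thesis using that by (simp add: f_def)
  qed
  have fin: "f j \<in> c (int (Suc j))" if "j < m" for j
  proof (cases "Suc j = p")
    case True
    then show ?thesis using wx by (simp add: f_def)
  qed (use f that in blast)
  have "inj_on f {0..<m}"
  proof (rule inj_onI)
    fix j k assume "j \<in> {0..<m}" "k \<in> {0..<m}" "f j = f k"
    then have "f j \<in> c (int (Suc j)) \<inter> c (int (Suc k))" using fin by (metis Int_iff atLeastLessThan_iff)
    then show "j = k" using c(1)[of "int (Suc j)" "int (Suc k)"] by auto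
  qed
  moreover have "x \<noteq> f j" if "j < m" for j
  proof (cases "Suc j = p")
    case False
    then show ?thesis using c(1)[of "int (Suc j)" "int p"] f[OF that] wx by auto
  qed (use wx in \<open>simp add: f_def\<close>)
  ultimately have "distinct (x # \<tau>)" by (fastforce simp: \<tau>_def distinct_map)
  moreover have "c i = initial_config \<tau> x p i" for i
  proof (cases "1 \<le> i \<and> i \<le> int m")
    case True
    then have "i = int (Suc (nat i - 1))" "nat i - 1 < m" using assms by linarith+
    then obtain j where j: "i = int (Suc j)" "j < m" by blast
    have n: "nat (1 + int j) - Suc 0 = j" by simp
    have "initial_config \<tau> x p i = {f j} \<union> (if Suc j = p then {x} else {})"
      using j n by (auto simp: initial_config_def \<tau>_def)
    moreover have "f j = w" if "Suc j = p" using that by (simp add: f_def)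
    ultimately show ?thesis using f[OF j(2)] wx(1) j(1) by (cases "Suc j = p") auto
  next
    case False
    then show ?thesis using c(2)[of i] assms by (auto simp: initial_config_def \<tau>_def)
  qed
  moreover have "length \<tau> = m" by (simp add: \<tau>_def)
  ultimately show ?thesis using that by blast
qed

section \<open>Counting preimages\<close>

fun records :: "nat \<Rightarrow> nat list \<Rightarrow> nat list" where
  "records c [] = []"
| "records c (x # xs) = (if c < x then x # records x xs else records c xs)"

lemma sorted_wrt_records: "sorted_wrt (<) (records c xs) \<and> (\<forall>x\<in>set (records c xs). c < x)"
proof (induction xs arbitrary: c)
  case (Cons x xs)
  show ?case using Cons.IH[of x] Cons.IH[of c] by (auto dest: less_trans)
qed simp

lemma in_ltr_maxima_iff:
  "y \<in> ltr_maxima xs \<longleftrightarrow> (\<exists>j<length xs. y = xs ! j \<and> xs ! j = Max (set (take (Suc j) xs)))"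
  by (auto simp: ltr_maxima_def)

lemma ltr_maxima_Nil: "ltr_maxima [] = {}"
  by (simp add: ltr_maxima_def)

lemma ltr_maxima_Cons: "ltr_maxima (x # xs) = insert x {y \<in> ltr_maxima xs. x \<le> y}"
proof -
  have "xs ! j = Max (set (take (Suc (Suc j)) (x # xs))) \<longleftrightarrow>
      xs ! j = Max (set (take (Suc j) xs)) \<and> x \<le> xs ! j" if "j < length xs" for j
  proof -
    have ne: "set (take (Suc j) xs) \<noteq> {}" using that by auto
    have "xs ! j \<in> set (take (Suc j) xs)" using that by (auto simp: take_Suc_conv_app_nth)
    then have "xs ! j \<le> Max (set (take (Suc j) xs))" by simp
    moreover have "Max (set (take (Suc (Suc j)) (x # xs))) = max x (Max (set (take (Suc j) xs)))"
      using ne by simp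
    ultimately show ?thesis by (auto simp: max_def)
  qed
  then have "y \<in> ltr_maxima (x # xs) \<longleftrightarrow> y = x \<or> (y \<in> ltr_maxima xs \<and> x \<le> y)" for y
    unfolding in_ltr_maxima_iff length_Cons Ex_less_Suc2 by auto
  then show ?thesis by blast
qed

lemma ltr_maxima_subset: "ltr_maxima xs \<subseteq> set xs"
  using nth_mem by (fastforce simp: in_ltr_maxima_iff)

text \<open>The threshold \<open>c\<close> makes the recursion on words possible. For positive
  labels, threshold 0 gives all left-to-right maxima.\<close>

lemma set_records: "set (records c xs) = {y \<in> ltr_maxima xs. c < y}"
  by (induction xs arbitrary: c) (auto simp: ltr_maxima_Nil ltr_maxima_Cons)

lemma in_rtl_minima_iff:
  "y \<in> rtl_minima xs \<longleftrightarrow> (\<exists>j<length xs. y = xs ! j \<and> xs ! j = Min (set (drop j xs)))"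
  by (auto simp: rtl_minima_def)

lemma rtl_minima_Nil: "rtl_minima [] = {}"
  by (simp add: rtl_minima_def)

lemma rtl_minima_Cons:
  "rtl_minima (x # xs) = rtl_minima xs \<union> (if \<forall>y\<in>set xs. x \<le> y then {x} else {})"
proof -
  have "x = Min (insert x (set xs)) \<longleftrightarrow> (\<forall>y\<in>set xs. x \<le> y)"
    by (subst eq_Min_iff) auto
  then have "y \<in> rtl_minima (x # xs) \<longleftrightarrow>
      y \<in> rtl_minima xs \<or> (y = x \<and> (\<forall>y\<in>set xs. x \<le> y))" for y
    unfolding in_rtl_minima_iff length_Cons Ex_less_Suc2 by auto
  then show ?thesis by auto
qed

lemma rtl_minima_subset: "rtl_minima xs \<subseteq> set xs"
  using nth_mem by (fastforce simp: in_rtl_minima_iff)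

lemma card_rtl_minima_Cons:
  assumes "z \<notin> set zs"
  shows "card (rtl_minima (z # zs))
    = (if \<forall>y\<in>set zs. z < y then Suc (card (rtl_minima zs)) else card (rtl_minima zs))"
proof -
  have "finite (rtl_minima zs)" "z \<notin> rtl_minima zs"
    using rtl_minima_subset[of zs] assms finite_subset by auto
  moreover have "(\<forall>y\<in>set zs. z \<le> y) \<longleftrightarrow> (\<forall>y\<in>set zs. z < y)"
    using assms by (metis order_less_le)
  ultimately show ?thesis by (simp add: rtl_minima_Cons)
qed

section \<open>Undoing one row\<close>

definition bubble_preimages :: "nat \<Rightarrow> nat list \<Rightarrow> (nat \<times> nat list) set" where
  "bubble_preimages z Y = {(w, ys). bubble w ys = (z, Y)}"

lemma bubble_preimages_Nil: "bubble_preimages z [] = {(z, [])}"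
proof -
  have "bubble w ys = (z, []) \<longleftrightarrow> w = z \<and> ys = []" for w ys
    by (cases ys) (auto split: prod.splits)
  then show ?thesis by (auto simp: bubble_preimages_def)
qed

text \<open>The first comparator emitted \<open>y\<close> and carried on with a larger chip
  \<open>u\<close>. Either \<open>y\<close> was the row chip and \<open>u\<close> headed the stream,
  or the reverse.\<close>

lemma bubble_preimages_Cons:
  assumes "y \<noteq> z" "y \<notin> set Y"
  shows "bubble_preimages z (y # Y) = (\<lambda>(u, xs). (y, u # xs)) ` {(u, xs) \<in> bubble_preimages z Y. y < u}
     \<union> (\<lambda>(u, xs). (u, y # xs)) ` {(u, xs) \<in> bubble_preimages z Y. y < u}" (is "_ = ?A \<union> ?B")
proof (intro equalityI subsetI)
  fix q assume "q \<in> bubble_preimages z (y # Y)"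
  then obtain w ys where q: "q = (w, ys)" "bubble w ys = (z, y # Y)" by (auto simp: bubble_preimages_def)
  then obtain x xs where xs: "ys = x # xs" "bubble (max w x) xs = (z, Y)" "min w x = y"
    by (cases ys) (auto split: prod.splits)
  have "max w x \<in># add_mset z (mset Y)" using mset_bubble[OF xs(2)] by simp
  then have "max w x \<noteq> y" using assms by auto
  then have "w < x \<and> y = w \<or> x < w \<and> y = x" using xs(3) by (auto simp: min_def max_def split: if_splits)
  then show "q \<in> ?A \<union> ?B" using q xs by (auto simp: bubble_preimages_def image_iff)
next
  fix q assume "q \<in> ?A \<union> ?B"
  then show "q \<in> bubble_preimages z (y # Y)" by (auto simp: bubble_preimages_def)
qed

lemma finite_bubble_preimages: "distinct (z # Y) \<Longrightarrow> finite (bubble_preimages z Y)"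
proof (induction Y)
  case (Cons y Y)
  then have "finite {(u, xs) \<in> bubble_preimages z Y. y < u}" by (auto intro: finite_subset[of _ "bubble_preimages z Y"])
  then show ?case using Cons.prems by (subst bubble_preimages_Cons) auto
qed (simp add: bubble_preimages_Nil)

text \<open>The threshold \<open>c\<close> concerns the row chip. This is \<open>y\<close> in the
  first branch and \<open>u\<close> in the second, where the bounds merge into
  \<open>max c y < u\<close>.\<close>

lemma sum_bubble_preimages_Cons:
  assumes "distinct (z # y # Y)"
  shows "(\<Sum>(u, xs) \<in> {(u, xs) \<in> bubble_preimages z (y # Y). c < u}. f u xs)
     = (if c < y then (\<Sum>(u, xs) \<in> {(u, xs) \<in> bubble_preimages z Y. y < u}. f y (u # xs)) else 0)
       + (\<Sum>(u, xs) \<in> {(u, xs) \<in> bubble_preimages z Y. max c y < u}. (f u (y # xs) :: int))"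
proof -
  let ?D = "{(u, xs) \<in> bubble_preimages z Y. y < u}"
  let ?E = "{(u, xs) \<in> bubble_preimages z Y. max c y < u}"
  let ?A = "(\<lambda>(u, xs). (y, u # xs)) ` (if c < y then ?D else {})"
  let ?B = "(\<lambda>(u, xs). (u, y # xs)) ` ?E"
  have fin: "finite ?D" "finite ?E" using finite_bubble_preimages[of z Y] assms
    by (auto intro: finite_subset[of _ "bubble_preimages z Y"])
  have "{(u, xs) \<in> bubble_preimages z (y # Y). c < u} = ?A \<union> ?B"
    using assms by (subst bubble_preimages_Cons) (auto split: if_splits)
  moreover have "?A \<inter> ?B = {}" by (auto split: if_splits)
  ultimately have "(\<Sum>(u, xs) \<in> {(u, xs) \<in> bubble_preimages z (y # Y). c < u}. f u xs)
      = (\<Sum>(u, xs) \<in> ?A. f u xs) + (\<Sum>(u, xs) \<in> ?B. f u xs)"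
    using fin by (simp add: sum.union_disjoint)
  also have "(\<Sum>(u, xs) \<in> ?A. f u xs) = (if c < y then (\<Sum>(u, xs) \<in> ?D. f y (u # xs)) else 0)"
    by (subst sum.reindex) (auto simp: inj_on_def case_prod_unfold)
  also have "(\<Sum>(u, xs) \<in> ?B. f u xs) = (\<Sum>(u, xs) \<in> ?E. f u (y # xs))"
    by (subst sum.reindex) (auto simp: inj_on_def case_prod_unfold)
  finally show ?thesis .
qed

text \<open>
  With \<open>L\<close> the word of left-to-right maxima before a row with output
  \<open>z\<close> is undone, \<open>keep_sum z h L\<close> sums \<open>h\<close> over the words
  of left-to-right maxima that can arise: either \<open>L\<close> stays, or its first chosen
  letter \<open>v\<close> is removed, some of the letters after \<open>v\<close> survive and
  \<open>z\<close> is appended. The summands after the removal of \<open>v\<close> are collected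
  by \<open>bump_sum\<close>.
\<close>

fun bump_sum :: "nat \<Rightarrow> (nat list \<Rightarrow> int) \<Rightarrow> nat list \<Rightarrow> int" where
  "bump_sum z h [] = h [z]"
| "bump_sum z h (v # L) = bump_sum z (\<lambda>T. h (v # T)) L + bump_sum z h L"

fun keep_sum :: "nat \<Rightarrow> (nat list \<Rightarrow> int) \<Rightarrow> nat list \<Rightarrow> int" where
  "keep_sum z h [] = h []"
| "keep_sum z h (v # L) = bump_sum z h L + keep_sum z (\<lambda>T. h (v # T)) L"

text \<open>A letter has been chosen before, and the word goes on with the carried chip
  \<open>u\<close>. In the first branch \<open>y\<close> precedes the larger \<open>u\<close> and
  survives as a maximum; in the second it follows \<open>u\<close> and is lost.\<close>

lemma sum_bubble_preimages_bump:
  assumes "distinct (z # Y)" "\<forall>y\<in>set Y. y < z" "c < z"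
  shows "(\<Sum>(u, xs) \<in> {(u, xs) \<in> bubble_preimages z Y. c < u}. h (u # records u xs)) = bump_sum z h (records c Y)"
  using assms
proof (induction Y arbitrary: c h)
  case Nil
  have "{(u, xs). (u, xs) \<in> bubble_preimages z [] \<and> c < u} = {(z, [])}" using Nil by (auto simp: bubble_preimages_Nil)
  then show ?case by simp
next
  case (Cons y Y)
  have *: "(\<Sum>(u, xs) \<in> {(u, xs) \<in> bubble_preimages z Y. y < u}. h (y # records y (u # xs)))
      = bump_sum z (\<lambda>T. h (y # T)) (records y Y)"
    using Cons.prems by (subst Cons.IH[symmetric]) (auto intro: sum.cong)
  have **: "(\<Sum>(u, xs) \<in> {(u, xs) \<in> bubble_preimages z Y. max c y < u}. h (u # records u (y # xs)))
      = bump_sum z h (records (max c y) Y)"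
    using Cons.prems by (subst Cons.IH[symmetric]) (auto intro!: sum.cong)
  show ?case unfolding sum_bubble_preimages_Cons[OF Cons.prems(1)] * ** by (auto simp: max_def)
qed

text \<open>Nothing has been chosen yet, and \<open>u\<close> is outside the word. If
  \<open>y\<close> becomes the row chip, it leaves as the first chosen letter and
  \<open>bump_sum\<close> takes over; otherwise it stays.\<close>

lemma sum_bubble_preimages_keep:
  assumes "distinct (z # Y)" "\<forall>y\<in>set Y. y < z" "c < z"
  shows "(\<Sum>(u, xs) \<in> {(u, xs) \<in> bubble_preimages z Y. c < u}. h (records c xs)) = keep_sum z h (records c Y)"
  using assms
proof (induction Y arbitrary: c h)
  case Nil
  have "{(u, xs). (u, xs) \<in> bubble_preimages z [] \<and> c < u} = {(z, [])}" using Nil by (auto simp: bubble_preimages_Nil)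
  then show ?case by simp
next
  case (Cons y Y)
  show ?case
  proof (cases "c < y")
    case True
    have *: "(\<Sum>(u, xs) \<in> {(u, xs) \<in> bubble_preimages z Y. y < u}. h (records c (u # xs))) = bump_sum z h (records y Y)"
      using Cons.prems True by (subst sum_bubble_preimages_bump[symmetric]) (auto intro!: sum.cong)
    have **: "(\<Sum>(u, xs) \<in> {(u, xs) \<in> bubble_preimages z Y. max c y < u}. h (records c (y # xs)))
        = keep_sum z (\<lambda>T. h (y # T)) (records y Y)"
      using Cons.prems True by (subst Cons.IH[symmetric]) (auto intro!: sum.cong simp: max_def)
    show ?thesis using True unfolding sum_bubble_preimages_Cons[OF Cons.prems(1)] * ** by simp
  next
    case False
    then have "max c y = c" by simp
    then show ?thesis using False Cons unfolding sum_bubble_preimages_Cons[OF Cons.prems(1)] by simp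
  qed
qed

section \<open>Undoing the whole network\<close>

definition sweep_preimages :: "nat \<Rightarrow> nat list \<Rightarrow> nat list \<Rightarrow> (nat list \<times> nat list) set" where
  "sweep_preimages r Z Y = {(ws, xs). sweep ws xs = (Y, Z) \<and> xs \<noteq> [] \<and> hd xs = r}"

lemma sweep_preimages_Nil: "sweep_preimages r [] Y = (if Y \<noteq> [] \<and> hd Y = r then {([], Y)} else {})"
proof -
  have "sweep ws xs = (Y, []) \<longleftrightarrow> ws = [] \<and> xs = Y" for ws xs
    by (cases ws) (auto split: prod.splits)
  then show ?thesis by (auto simp: sweep_preimages_def)
qed

text \<open>\<open>sweep\<close> runs the first row last, so it is undone first. In
  \<open>?g\<close> the stream entering it is recovered by running the other rows forwards.\<close>

lemma bij_betw_sweep_preimages_Cons: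
  "bij_betw (\<lambda>((w, ys), (ws, xs)). (w # ws, xs)) (SIGMA q : bubble_preimages z Y. sweep_preimages r Z (snd q)) (sweep_preimages r (z # Z) Y)"
  (is "bij_betw ?f ?A ?B")
proof -
  let ?g = "\<lambda>(ws, xs). ((hd ws, fst (sweep (tl ws) xs)), (tl ws, xs))"
  have B: "?g (ws, xs) \<in> ?A \<and> ?f (?g (ws, xs)) = (ws, xs)" if "(ws, xs) \<in> ?B" for ws xs
    using that by (cases ws) (auto simp: sweep_preimages_def bubble_preimages_def split: prod.splits)
  show ?thesis
  proof (rule bij_betw_byWitness[where f' = ?g])
    show "\<forall>a\<in>?A. ?g (?f a) = a" "?f ` ?A \<subseteq> ?B" by (auto simp: sweep_preimages_def bubble_preimages_def)
    show "\<forall>b\<in>?B. ?f (?g b) = b" "?g ` ?B \<subseteq> ?A" using B by (fast, fast)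
  qed
qed

text \<open>Only maxima are tracked: the first letter of a word of positive labels heads its
  \<open>records\<close>. The guard reflects that a row outputs its largest chip.\<close>

fun undo_count :: "nat \<Rightarrow> nat list \<Rightarrow> nat list \<Rightarrow> int" where
  "undo_count r [] L = (if L \<noteq> [] \<and> hd L = r then 1 else 0)"
| "undo_count r (z # Z) L = (if \<forall>v\<in>set L. v < z then keep_sum z (undo_count r Z) L else 0)"

text \<open>The largest letter of a word is one of its left-to-right maxima, so these decide the
  comparison with \<open>z\<close>.\<close>

lemma records_less_iff:
  "0 \<notin> set xs \<Longrightarrow> (\<forall>v\<in>set (records 0 xs). v < z) \<longleftrightarrow> (\<forall>v\<in>set xs. v < z)"
proof -
  have "(\<forall>v\<in>set (records c xs). v < z) \<longleftrightarrow> (\<forall>v\<in>set xs. c < v \<longrightarrow> v < z)" for c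
  proof (induction xs arbitrary: c)
    case (Cons x xs)
    show ?case by (auto simp: Cons.IH)
  qed simp
  then show "0 \<notin> set xs \<Longrightarrow> ?thesis" by (metis gr0I)
qed

lemma card_sweep_preimages:
  assumes "distinct (Y @ Z)" "0 \<notin> set (Y @ Z)"
  shows "finite (sweep_preimages r Z Y) \<and> int (card (sweep_preimages r Z Y)) = undo_count r Z (records 0 Y)"
  using assms
proof (induction Z arbitrary: Y)
  case Nil
  then show ?case by (cases Y) (auto simp: sweep_preimages_Nil)
next
  case (Cons z Z)
  have dz: "distinct (z # Y)" using Cons.prems by auto
  have mem: "distinct (w # ys)" "set (w # ys) = set (z # Y)" if "(w, ys) \<in> bubble_preimages z Y" for w ys
  proof -
    have m: "mset (z # Y) = mset (w # ys)" using mset_bubble[of w ys z Y] that by (simp add: bubble_preimages_def)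
    show "distinct (w # ys)" using dz mset_eq_imp_distinct_iff[OF m] by simp
    show "set (w # ys) = set (z # Y)" using mset_eq_setD[OF m] by simp
  qed
  have IH: "finite (sweep_preimages r Z ys) \<and> int (card (sweep_preimages r Z ys)) = undo_count r Z (records 0 ys)"
    if "(w, ys) \<in> bubble_preimages z Y" for w ys
    using mem[OF that] Cons.prems by (intro Cons.IH) auto
  have fb: "finite (bubble_preimages z Y)" using finite_bubble_preimages[OF dz] .
  have fin: "finite (SIGMA q : bubble_preimages z Y. sweep_preimages r Z (snd q))"
    using fb IH by (intro finite_SigmaI) auto
  have "int (card (sweep_preimages r (z # Z) Y)) = int (card (SIGMA q : bubble_preimages z Y. sweep_preimages r Z (snd q)))"
    using bij_betw_same_card[OF bij_betw_sweep_preimages_Cons] by metis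
  also have "\<dots> = (\<Sum>q\<in>bubble_preimages z Y. int (card (sweep_preimages r Z (snd q))))"
    using fb IH by (subst card_SigmaI) auto
  also have "\<dots> = (\<Sum>(w, ys)\<in>bubble_preimages z Y. undo_count r Z (records 0 ys))"
    using IH by (intro sum.cong) auto
  also have "\<dots> = undo_count r (z # Z) (records 0 Y)"
  proof (cases "\<forall>v\<in>set Y. v < z")
    case True
    \<comment> \<open>All chips are positive, so threshold 0 discards no preimage.\<close>
    have "w > 0" if "(w, ys) \<in> bubble_preimages z Y" for w ys
    proof (rule gr0I)
      assume "w = 0"
      then have "0 \<in> set (z # Y)" using mem(2)[OF that] by auto
      then show False using Cons.prems by auto
    qed
    then have "bubble_preimages z Y = {(u, xs) \<in> bubble_preimages z Y. 0 < u}" by auto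
    moreover have "0 < z" using Cons.prems by auto
    ultimately show ?thesis
      using sum_bubble_preimages_keep[OF dz True, of 0 "undo_count r Z"] True records_less_iff[of Y z] Cons.prems by simp
  next
    case False
    have "v < z" if "(w, ys) \<in> bubble_preimages z Y" "v \<in> set Y" for w ys v
      using bubble_max[of w ys z Y] that dz by (force simp: bubble_preimages_def le_less)
    then have "bubble_preimages z Y = {}" using False by auto
    moreover have "\<not> (\<forall>v\<in>set (records 0 Y). v < z)"
      using False records_less_iff[of Y z] Cons.prems by simp
    ultimately show ?thesis by (simp only: undo_count.simps if_False sum.empty)
  qed
  finally show ?case using fin bij_betw_finite[OF bij_betw_sweep_preimages_Cons] by blast
qed

section \<open>Evaluating the sums over chosen letters\<close>

lemma bump_sum_zero: "(\<And>T. set T \<subseteq> set L \<Longrightarrow> h (T @ [z]) = 0) \<Longrightarrow> bump_sum z h L = 0"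
proof (induction L arbitrary: h)
  case Nil
  show ?case using Nil[of "[]"] by simp
next
  case (Cons v L)
  have "bump_sum z h L = 0" by (rule Cons.IH, rule Cons.prems) auto
  moreover have "bump_sum z (\<lambda>T. h (v # T)) L = 0"
    by (rule Cons.IH) (use Cons.prems[of "v # _"] in auto)
  ultimately show ?case by simp
qed

text \<open>Every nonempty choice yields a word ending in \<open>z\<close>, so only the empty one
  contributes.\<close>

lemma keep_sum_no_bump: "(\<And>T. set T \<subseteq> set L \<Longrightarrow> h (T @ [z]) = 0) \<Longrightarrow> keep_sum z h L = h L"
proof (induction L arbitrary: h)
  case (Cons v L)
  have "bump_sum z h L = 0" by (rule bump_sum_zero, rule Cons.prems) auto
  moreover have "keep_sum z (\<lambda>T. h (v # T)) L = h (v # L)"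
    by (rule Cons.IH) (use Cons.prems[of "v # _"] in auto)
  ultimately show ?case by simp
qed simp

text \<open>Each set of positions in \<open>J\<close> gives one \<open>T\<close>, so length
  \<open>d\<close> occurs \<open>length J choose d\<close> times.\<close>

lemma bump_sum_length:
  "(\<And>T. set T \<subseteq> set J \<Longrightarrow> h (T @ [z]) = f (length T)) \<Longrightarrow> bump_sum z h J = binomial_transform f (length J)"
proof (induction J arbitrary: h f)
  case Nil
  show ?case using Nil[of "[]"] by simp
next
  case (Cons v J)
  have "bump_sum z h J = binomial_transform f (length J)" by (rule Cons.IH, rule Cons.prems) auto
  moreover have "bump_sum z (\<lambda>T. h (v # T)) J = binomial_transform (\<lambda>d. f (Suc d)) (length J)"
    by (rule Cons.IH) (use Cons.prems[of "v # _"] in auto)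
  ultimately show ?case by simp
qed

text \<open>Nonempty choices give each proper subword of \<open>J\<close>, followed by
  \<open>z\<close>, exactly once: its first missing letter is the first chosen one. So the full
  transform loses only the term of \<open>J\<close> itself, and the empty choice adds
  \<open>h J\<close>.\<close>

lemma keep_sum_length:
  assumes "\<And>T. set T \<subseteq> set J \<Longrightarrow> h (T @ [z]) = f (Suc (length T))" "h J = f (length J)"
  shows "keep_sum z h J = f (length J) - f (Suc (length J)) + binomial_transform (\<lambda>d. f (Suc d)) (length J)"
  using assms
proof (induction J arbitrary: h f)
  case Nil
  then show ?case by simp
next
  case (Cons v J)
  have "bump_sum z h J = binomial_transform (\<lambda>d. f (Suc d)) (length J)"
    by (rule bump_sum_length, rule Cons.prems(1)) auto
  moreover have "keep_sum z (\<lambda>T. h (v # T)) J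
      = f (Suc (length J)) - f (Suc (Suc (length J))) + binomial_transform (\<lambda>d. f (Suc (Suc d))) (length J)"
    by (rule Cons.IH) (use Cons.prems(1)[of "v # _"] Cons.prems(2) in auto)
  ultimately show ?case by simp
qed

text \<open>Only words that keep \<open>r\<close> contribute, and the survivors from
  \<open>I\<close> and from \<open>J\<close> are selected independently.\<close>

lemma bump_sum_marked:
  assumes "\<And>S T. set S \<subseteq> set I \<Longrightarrow> set T \<subseteq> set J \<Longrightarrow> h (S @ r # T @ [z]) = g (length S) (Suc (length T))"
    and "\<And>T. set T \<subseteq> set I \<union> set J \<Longrightarrow> h (T @ [z]) = 0"
  shows "bump_sum z h (I @ r # J) = binomial_transform (\<lambda>s. binomial_transform (\<lambda>d. g s (Suc d)) (length J)) (length I)"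
  using assms
proof (induction I arbitrary: h g)
  case Nil
  have "bump_sum z h J = 0" by (rule bump_sum_zero) (auto intro: Nil)
  moreover have "bump_sum z (\<lambda>T. h (r # T)) J = binomial_transform (\<lambda>d. g 0 (Suc d)) (length J)"
    by (rule bump_sum_length) (use Nil(1)[of "[]"] in auto)
  ultimately show ?case by simp
next
  case (Cons v I)
  have marked: "h (v # S @ r # T @ [z]) = g (Suc (length S)) (Suc (length T))"
    if "set S \<subseteq> set I" "set T \<subseteq> set J" for S T
    using Cons.prems(1)[of "v # S" T] that by auto
  have unmarked: "h (v # T @ [z]) = 0" if "set T \<subseteq> set I \<union> set J" for T
    using Cons.prems(2)[of "v # T"] that by auto
  have "bump_sum z h (I @ r # J) = binomial_transform (\<lambda>s. binomial_transform (\<lambda>d. g s (Suc d)) (length J)) (length I)"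
    by (rule Cons.IH; rule Cons.prems) auto
  moreover have "bump_sum z (\<lambda>T. h (v # T)) (I @ r # J)
      = binomial_transform (\<lambda>s. binomial_transform (\<lambda>d. g (Suc s) (Suc d)) (length J)) (length I)"
    by (rule Cons.IH) (use marked unmarked in simp_all)
  ultimately show ?case by simp
qed

text \<open>As in \<open>keep_sum_length\<close>, but with the subwords that keep \<open>r\<close>;
  the term lost is that of \<open>I @ r # J @ [z]\<close>.\<close>

lemma keep_sum_marked:
  assumes "\<And>S T. set S \<subseteq> set I \<Longrightarrow> set T \<subseteq> set J \<Longrightarrow> h (S @ r # T @ [z]) = g (length S) (Suc (length T))"
    and "\<And>T. set T \<subseteq> set I \<union> set J \<Longrightarrow> h (T @ [z]) = 0"
    and "h (I @ r # J) = g (length I) (length J)"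
  shows "keep_sum z h (I @ r # J) = g (length I) (length J) - g (length I) (Suc (length J))
    + binomial_transform (\<lambda>s. binomial_transform (\<lambda>d. g s (Suc d)) (length J)) (length I)"
  using assms
proof (induction I arbitrary: h g)
  case Nil
  have "bump_sum z h J = 0" by (rule bump_sum_zero) (auto intro: Nil)
  moreover have "keep_sum z (\<lambda>T. h (r # T)) J
      = g 0 (length J) - g 0 (Suc (length J)) + binomial_transform (\<lambda>d. g 0 (Suc d)) (length J)"
    by (rule keep_sum_length) (use Nil(1)[of "[]"] Nil(3) in auto)
  ultimately show ?case by simp
next
  case (Cons v I)
  have marked: "h (v # S @ r # T @ [z]) = g (Suc (length S)) (Suc (length T))"
    if "set S \<subseteq> set I" "set T \<subseteq> set J" for S T
    using Cons.prems(1)[of "v # S" T] that by auto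
  have unmarked: "h (v # T @ [z]) = 0" if "set T \<subseteq> set I \<union> set J" for T
    using Cons.prems(2)[of "v # T"] that by auto
  have "bump_sum z h (I @ r # J) = binomial_transform (\<lambda>s. binomial_transform (\<lambda>d. g s (Suc d)) (length J)) (length I)"
    by (rule bump_sum_marked; rule Cons.prems) auto
  moreover have "keep_sum z (\<lambda>T. h (v # T)) (I @ r # J)
      = g (Suc (length I)) (length J) - g (Suc (length I)) (Suc (length J))
        + binomial_transform (\<lambda>s. binomial_transform (\<lambda>d. g (Suc s) (Suc d)) (length J)) (length I)"
    by (rule Cons.IH) (use marked unmarked Cons.prems(3) in simp_all)
  ultimately show ?case by simp
qed

text \<open>Only letters of \<open>Z\<close> can enter the word, so a missing \<open>r\<close> never
  gets to the front.\<close>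

lemma undo_count_missing: "r \<notin> set L \<Longrightarrow> r \<notin> set Z \<Longrightarrow> undo_count r Z L = 0"
proof (induction Z arbitrary: L)
  case Nil
  then show ?case by (cases L) auto
next
  case (Cons z Z)
  have "keep_sum z (undo_count r Z) L = undo_count r Z L"
    by (rule keep_sum_no_bump, rule Cons.IH) (use Cons.prems in auto)
  then show ?case using Cons by auto
qed

text \<open>Undoing a row keeps \<open>v\<close> or inserts the row output, which exceeds
  \<open>v\<close> by the guard. So some letter not below \<open>z'\<close> remains until the guard
  fails, at the row of \<open>z'\<close> at the latest.\<close>

lemma undo_count_not_less: "v \<in> set L \<Longrightarrow> z' \<in> set Z \<Longrightarrow> z' \<le> v \<Longrightarrow> undo_count r Z L = 0"
proof (induction Z arbitrary: L v)
  case (Cons z Z)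
  show ?case
  proof (cases "\<forall>v\<in>set L. v < z")
    case True
    then have z': "z' \<in> set Z" "z' \<le> z" using Cons.prems by auto
    have "keep_sum z (undo_count r Z) L = undo_count r Z L"
      by (rule keep_sum_no_bump, rule Cons.IH[of z]) (use z' in auto)
    also have "\<dots> = 0" using Cons.IH[OF Cons.prems(1) z'(1) Cons.prems(3)] .
    finally show ?thesis by simp
  qed auto
qed simp

text \<open>If \<open>z\<close> is below all later row outputs, it is a right-to-left minimum, and
  once inserted it acts as a new last letter of \<open>J\<close>: this is \<open>diffB_Suc\<close>.
  Otherwise only the empty choice can be continued, and nothing changes.\<close>

lemma undo_count_eq_diffB:
  assumes "r \<notin> set I" "r \<notin> set J" "r \<notin> set Z" "distinct Z"
    and "\<And>v z. v \<in> set (I @ r # J) \<Longrightarrow> z \<in> set Z \<Longrightarrow> v < z"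
  shows "undo_count r Z (I @ r # J) = diffB (card (rtl_minima Z)) (length I) (length J)"
  using assms
proof (induction Z arbitrary: I J)
  case Nil
  then show ?case by (cases I) (auto simp: rtl_minima_Nil diffB_k0)
next
  case (Cons z Z)
  let ?g = "diffB (card (rtl_minima Z))"
  have step: "undo_count r (z # Z) (I @ r # J) = keep_sum z (undo_count r Z) (I @ r # J)"
    using Cons.prems(5) by auto
  have IH: "undo_count r Z (I @ r # J) = ?g (length I) (length J)"
    by (rule Cons.IH) (use Cons.prems in auto)
  show ?case
  proof (cases "\<forall>y\<in>set Z. z < y")
    case True
    have "keep_sum z (undo_count r Z) (I @ r # J) = ?g (length I) (length J) - ?g (length I) (Suc (length J))
        + binomial_transform (\<lambda>s. binomial_transform (\<lambda>d. ?g s (Suc d)) (length J)) (length I)"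
    proof (rule keep_sum_marked)
      fix S T assume ST: "set S \<subseteq> set I" "set T \<subseteq> set J"
      have "undo_count r Z (S @ r # (T @ [z])) = ?g (length S) (length (T @ [z]))"
        by (rule Cons.IH) (use Cons.prems ST True in auto)
      then show "undo_count r Z (S @ r # T @ [z]) = ?g (length S) (Suc (length T))" by simp
    next
      fix T assume "set T \<subseteq> set I \<union> set J"
      then show "undo_count r Z (T @ [z]) = 0" using Cons.prems by (intro undo_count_missing) auto
    qed (rule IH)
    then show ?thesis using True Cons.prems(4) unfolding step by (simp add: card_rtl_minima_Cons diffB_Suc)
  next
    case False
    then obtain z' where z': "z' \<in> set Z" "z' \<le> z" by (auto simp: not_less)
    have "keep_sum z (undo_count r Z) (I @ r # J) = undo_count r Z (I @ r # J)"
      by (rule keep_sum_no_bump, rule undo_count_not_less[of z _ z']) (use z' in auto)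
    then show ?thesis using False Cons.prems(4) unfolding step by (auto simp: IH card_rtl_minima_Cons)
  qed
qed

text \<open>Cutting the relabelled word at \<open>p\<close> gives rows and columns, with
  \<open>r\<close> as first column. Conversely, dropping \<open>r\<close> and closing the gap in the
  labels recovers \<sigma>.\<close>

lemma bij_betw_sigma_sweep_preimages:
  assumes "1 \<le> p" "p < n" "1 \<le> r" "r \<le> n" and \<pi>: "perm_list n \<pi>"
  shows "bij_betw (\<lambda>\<sigma>. let \<tau> = map (\<lambda>v. if v < r then v else v + 1) \<sigma> in (take p \<tau>, r # drop p \<tau>))
    {\<sigma>. perm_list (n - 1) \<sigma> \<and> topples_to (sigma_rp \<sigma> r p) \<pi>}
    (sweep_preimages r (drop (n - p) \<pi>) (take (n - p) \<pi>))"
proof -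
  let ?up = "\<lambda>v. if v < r then v else v + (1::nat)"
  let ?down = "\<lambda>u. if u < r then u else u - (1::nat)"
  let ?F = "\<lambda>\<sigma>. let \<tau> = map ?up \<sigma> in (take p \<tau>, r # drop p \<tau>)"
  let ?G = "\<lambda>(ws, xs). map ?down (ws @ tl xs)"
  let ?A = "{\<sigma>. perm_list (n - 1) \<sigma> \<and> topples_to (sigma_rp \<sigma> r p) \<pi>}"
  let ?B = "sweep_preimages r (drop (n - p) \<pi>) (take (n - p) \<pi>)"
  have topples: "topples_to (sigma_rp \<sigma> r p) \<pi> \<longleftrightarrow> ?F \<sigma> \<in> ?B" if \<sigma>: "perm_list (n - 1) \<sigma>" for \<sigma>
  proof -
    let ?\<tau> = "map ?up \<sigma>"
    have len: "length ?\<tau> = n - 1" using \<sigma> by (simp add: perm_list_def)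
    have "distinct (r # ?\<tau>)"
      using \<sigma> by (auto simp: perm_list_def distinct_map inj_on_def split: if_splits)
    then have "topples_to (sigma_rp \<sigma> r p) \<pi> \<longleftrightarrow>
        (\<exists>ys zs. sweep (take p ?\<tau>) (r # drop p ?\<tau>) = (ys, zs) \<and> \<pi> = ys @ zs)"
      unfolding sigma_rp_eq_initial_config using assms(1,2) len by (intro topples_to_initial_config) auto
    \<comment> \<open>There are \<open>n - p\<close> columns, which fixes where \<pi> is
      cut.\<close>
    also have "\<dots> \<longleftrightarrow> sweep (take p ?\<tau>) (r # drop p ?\<tau>) = (take (n - p) \<pi>, drop (n - p) \<pi>)"
    proof
      assume "\<exists>ys zs. sweep (take p ?\<tau>) (r # drop p ?\<tau>) = (ys, zs) \<and> \<pi> = ys @ zs"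
      then obtain ys zs where s: "sweep (take p ?\<tau>) (r # drop p ?\<tau>) = (ys, zs)" "\<pi> = ys @ zs" by blast
      have "length ys = n - p" using length_sweep[OF s(1)] len assms(1,2) by simp
      then show "sweep (take p ?\<tau>) (r # drop p ?\<tau>) = (take (n - p) \<pi>, drop (n - p) \<pi>)"
        using s by simp
    next
      assume "sweep (take p ?\<tau>) (r # drop p ?\<tau>) = (take (n - p) \<pi>, drop (n - p) \<pi>)"
      then show "\<exists>ys zs. sweep (take p ?\<tau>) (r # drop p ?\<tau>) = (ys, zs) \<and> \<pi> = ys @ zs"
        by (intro exI conjI) auto
    qed
    finally show ?thesis by (simp add: sweep_preimages_def Let_def)
  qed
  have inv1: "?G (?F \<sigma>) = \<sigma>" for \<sigma>
  proof -
    have "?G (?F \<sigma>) = map ?down (map ?up \<sigma>)"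
      by (simp only: Let_def prod.case list.sel append_take_drop_id)
    also have "\<dots> = map id \<sigma>" unfolding map_map by (intro map_cong) auto
    finally show ?thesis by simp
  qed
  have inv2: "?F (?G b) = b \<and> perm_list (n - 1) (?G b)" if bB: "b \<in> ?B" for b
  proof -
    obtain ws xs where b: "b = (ws, r # xs)" and s: "sweep ws (r # xs) = (take (n - p) \<pi>, drop (n - p) \<pi>)"
      using bB by (cases b) (auto simp: sweep_preimages_def neq_Nil_conv)
    have len: "length ws = p" "length xs = n - p - 1"
      using length_sweep[OF s] \<pi> assms(1,2) by (auto simp: perm_list_def)
    have m: "mset \<pi> = mset (ws @ r # xs)" using mset_sweep[OF s] by (simp only: append_take_drop_id)
    have "distinct (ws @ r # xs)" using \<pi> mset_eq_imp_distinct_iff[OF m] by (simp add: perm_list_def)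
    then have d: "distinct (ws @ xs)" "r \<notin> set (ws @ xs)" by auto
    have st: "set (ws @ r # xs) = {1..n}" using \<pi> mset_eq_setD[OF m] by (simp add: perm_list_def)
    have up_down: "?up (?down u) = u" if "u \<in> set (ws @ xs)" for u
    proof -
      have "u \<noteq> r" using that d(2) by blast
      then show ?thesis by auto
    qed
    have "map ?up (map ?down (ws @ xs)) = ws @ xs"
      unfolding map_map by (rule map_idI) (simp only: o_apply up_down)
    then have F: "?F (?G b) = b" using len by (simp add: b Let_def del: map_append)
    have G: "?G b = map ?down (ws @ xs)" by (simp add: b)
    have dG: "distinct (?G b)"
      unfolding G distinct_map using d(1) inj_on_inverseI[of "set (ws @ xs)" ?up, OF up_down] by blast
    have lG: "length (?G b) = n - 1" using len assms(1,2) by (simp add: b)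
    have "set (?G b) \<subseteq> {1..n - 1}"
    proof
      fix v assume "v \<in> set (?G b)"
      then obtain u where "u \<in> set (ws @ xs)" "v = ?down u" unfolding G set_map by blast
      moreover from this have "u \<in> {1..n}" "u \<noteq> r" using st d(2) by auto
      ultimately show "v \<in> {1..n - 1}" using assms(3,4) by auto
    qed
    then have "set (?G b) = {1..n - 1}"
      using distinct_card[OF dG] lG by (intro card_subset_eq) auto
    then show ?thesis using F dG lG by (simp add: perm_list_def)
  qed
  show ?thesis
  proof (rule bij_betw_byWitness[where f' = ?G])
    show "\<forall>\<sigma>\<in>?A. ?G (?F \<sigma>) = \<sigma>" using inv1 by blast
    show "\<forall>b\<in>?B. ?F (?G b) = b" using inv2 by blast
    show "?F ` ?A \<subseteq> ?B" using topples by blast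
    show "?G ` ?B \<subseteq> ?A"
    proof
      fix \<sigma> assume "\<sigma> \<in> ?G ` ?B"
      then obtain b where b: "b \<in> ?B" "\<sigma> = ?G b" by blast
      then show "\<sigma> \<in> ?A" using inv2[OF b(1)] topples[of \<sigma>] by simp
    qed
  qed
qed

text \<open>A resultant word is a network output, so \<open>sweep_le\<close> applies; distinct
  labels make the inequality strict.\<close>

lemma p_resultant_less:
  assumes "p_resultant n p \<pi>" "perm_list n \<pi>" "1 \<le> p" "p < n"
    and "y \<in> set (take (n - p) \<pi>)" "z \<in> set (drop (n - p) \<pi>)"
  shows "y < z"
proof -
  obtain c where c: "c \<in> config_S (n - 1) p" "topples_to c \<pi>"
    using assms(1) unfolding p_resultant_def by blast
  have pm: "p \<le> n - 1" using assms(4) by simp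
  obtain \<tau> x where \<tau>: "c = initial_config \<tau> x p" "distinct (x # \<tau>)" "length \<tau> = n - 1"
    using config_S_eq_initial_config[OF c(1) assms(3) pm] .
  obtain ys zs where s: "sweep (take p \<tau>) (x # drop p \<tau>) = (ys, zs)" "\<pi> = ys @ zs"
    using c(2) topples_to_initial_config[of p \<tau> x \<pi>] \<tau> assms(3) pm by auto
  have "length ys = n - p" using length_sweep[OF s(1)] \<tau>(3) assms(3,4) by simp
  then have "y \<in> set ys" "z \<in> set zs" using assms(5,6) s(2) by auto
  moreover from this have "y \<noteq> z" using assms(2) s(2) by (auto simp: perm_list_def)
  ultimately show ?thesis using sweep_le[OF s(1)] by (simp add: le_neq_implies_less)
qed

theorem theorem2p14:
  fixes n p r :: nat and \<pi> :: "nat list"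
  assumes "n \<ge> 2" and "1 \<le> p" and "p \<le> n - 1" and "1 \<le> r" and "r \<le> n - p"
    and "perm_list n \<pi>" and "p_resultant n p \<pi>"
    and "r \<in> ltr_maxima (take (n - p) \<pi>)"
  shows "int (card {\<sigma>. perm_list (n - 1) \<sigma> \<and> topples_to (sigma_rp \<sigma> r p) \<pi>}) =
           (fwd_diff ^^ card {x \<in> ltr_maxima (take (n - p) \<pi>). x < r})
             (\<lambda>m. polyB m (card (rtl_minima (drop (n - p) \<pi>))))
             (card {x \<in> ltr_maxima (take (n - p) \<pi>). x > r})
       \<and> int (card {\<sigma>. perm_list (n - 1) \<sigma> \<and> topples_to (sigma_rp \<sigma> r p) \<pi>}) =
           (\<Sum>t = 0..card {x \<in> ltr_maxima (take (n - p) \<pi>). x < r}.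
              (-1) ^ (card {x \<in> ltr_maxima (take (n - p) \<pi>). x < r} - t)
              * int (card {x \<in> ltr_maxima (take (n - p) \<pi>). x < r} choose t)
              * polyB (card {x \<in> ltr_maxima (take (n - p) \<pi>). x > r} + t)
                      (card (rtl_minima (drop (n - p) \<pi>))))"
proof -
  let ?Y = "take (n - p) \<pi>" and ?Z = "drop (n - p) \<pi>"
  have pn: "p < n" using assms(1,3) by simp
  have YZ: "distinct (?Y @ ?Z)" "0 \<notin> set (?Y @ ?Z)" using assms(6) by (auto simp: perm_list_def)
  have less: "y < z" if "y \<in> set ?Y" "z \<in> set ?Z" for y z
    using p_resultant_less[OF assms(7,6,2) pn that] .
  have sub: "ltr_maxima ?Y \<subseteq> set ?Y" by (rule ltr_maxima_subset)
  have "0 \<notin> ltr_maxima ?Y" using sub YZ(2) unfolding set_append by blast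
  then have "0 < y" if "y \<in> ltr_maxima ?Y" for y using that by (cases y) simp_all
  then have rec: "set (records 0 ?Y) = ltr_maxima ?Y" unfolding set_records by blast
  with assms(8) have "r \<in> set (records 0 ?Y)" by simp
  \<comment> \<open>Since \<open>records\<close> is increasing, \<open>I\<close> consists of the
    maxima below \<open>r\<close> and \<open>J\<close> of those above it.\<close>
  then obtain I J where L: "records 0 ?Y = I @ r # J" using split_list by fast
  have "sorted_wrt (<) (I @ r # J)" using sorted_wrt_records[of 0 ?Y] L by simp
  then have IJ: "\<forall>x\<in>set I. x < r" "\<forall>x\<in>set J. r < x" "distinct I" "distinct J"
    by (auto simp: sorted_wrt_append strict_sorted_iff)
  have "{x \<in> ltr_maxima ?Y. x < r} = set I" "{x \<in> ltr_maxima ?Y. x > r} = set J"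
    unfolding rec[symmetric] L using IJ by auto
  then have cards: "card {x \<in> ltr_maxima ?Y. x < r} = length I" "card {x \<in> ltr_maxima ?Y. x > r} = length J"
    using IJ distinct_card by auto
  have "set (I @ r # J) \<subseteq> set ?Y" using rec L sub by simp
  moreover have "r \<notin> set ?Z" using sub assms(8) less by fastforce
  ultimately have "undo_count r ?Z (I @ r # J) = diffB (card (rtl_minima ?Z)) (length I) (length J)"
    using IJ YZ(1) less by (intro undo_count_eq_diffB) auto
  moreover have "int (card {\<sigma>. perm_list (n - 1) \<sigma> \<and> topples_to (sigma_rp \<sigma> r p) \<pi>})
      = undo_count r ?Z (I @ r # J)"
    using bij_betw_same_card[OF bij_betw_sigma_sweep_preimages[OF assms(2) pn assms(4) _ assms(6)]]
      card_sweep_preimages[OF YZ, of r] L assms(5) by simp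
  ultimately show ?thesis
    unfolding cards by (simp add: diffB_def fwd_diff_funpow)
qed

end
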